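(* Consider the infinite-horizon symmetric Cobb–Douglas economy described in the context, with $\psi_c(t)=e^{-rt}$ and $\psi_x(t)=e^{-rt+\sigma W(t)}$, $\sigma>0$, for a one-dimensional Brownian motion $W$ and some $r$ such that $\sqrt{2r}>\frac{\sigma\alpha}{1-\alpha-\beta}$. Let $C_*$ and $\hat C$ be the aggregate public good contributions in the social planner's optimum and in the symmetric Nash equilibrium, respectively, under irreversible contributions, and $c_*$ and $\hat c$ the corresponding aggregate contributions under perfectly reversible contributions. Then $$\frac{\hat C(t)}{C_*(t)}=\frac{\hat c(t)}{c_*(t)}\le1;$$ that is, irreversibility of the public good contributions does not influence the degree of free-riding.
   Context: Economy. Horizon $T=\infty$, $n\ge1$ agents, filtered probability space $(\Omega,\mathcal{F},\{\mathcal{F}_t\},P)$ satisfying the usual conditions, constant discount rate $r>0$. All agents have the same initial wealth $w_o>0$ and utility $u(x,c)=\frac{x^\alpha c^\beta}{\alpha+\beta}$ with $\alpha,\beta\in(0,1)$, $\alpha+\beta<1$. Processes $\hat c/c_*$ are compared $P\otimes dt$-a.e. Irreversible case. Individual strategies are nonnegative optional pairs $(x^i,C^i)$ with $C^i$ right-continuous, nondecreasing, $C^i(0-)=0$; cost $\Psi(x^i,C^i)=E[\int_0^\infty\psi_x(t)x^i(t)dt+\int_0^\infty\psi_c(t)dC^i(t)]$, where $dC^i$ includes the point mass $C^i(0)$ at $0$. Agent $i$'s payoff is $E[\int_0^\infty e^{-rt}u(x^i(t),C(t))dt]$, $C=\sum_jC^j$. The social planner maximizes the average ($\gamma^i=1/n$)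 of the payoffs subject to $\sum_i\Psi(x^i,C^i)\le nw_o$; in a Nash equilibrium each agent maximizes his own payoff subject to $\Psi(x^i,C^i)\le w_o$, taking $C^{-i}=\sum_{j\ne i}C^j$ as given. $C_*$ is the planner's optimal aggregate contribution, $\hat C$ the aggregate contribution in the symmetric Nash equilibrium (all agents using the same strategy). Explicitly, $C_*=l_0\theta$ and $\hat C=\kappa\theta$, where, with $\mathcal{E}_x(t)=e^{\sigma W(t)}$ and $\delta:=\frac\beta\alpha(\frac{\alpha+\beta}\alpha)^{\frac1{\alpha-1}}$, $$A:=E\Big[\int_0^\infty\delta e^{-ru}\inf_{0\le s\le u}\mathcal{E}_x^{-\frac\alpha{1-\alpha}}(u-s)\,du\Big],\quad\theta(t):=\sup_{0\le s\le t}\mathcal{E}_x^{-\frac\alpha{1-\alpha-\beta}}(s),\quad\gamma(t):=\frac1A\Big[\frac{\alpha+\beta}\alpha\,\mathcal{E}_x(t)\inf_{0\le s\le t}\mathcal{E}_x^{\frac{\alpha\beta}{1-\alpha-\beta}}(s)\Big]^{-\frac1{1-\alpha}},$$ $$l_0:=\frac{nw_o}{E[\int_0^\infty\psi_x\gamma\,dt+\int_0^\infty\psi_c\,d\theta]},\qquad\kappa:=\frac{w_o}{E[\int_0^\infty\psi_x\gamma\,dt+\frac1n\int_0^\infty\psi_c\,d\theta]}.$$ Reversible case. Individual strategies are nonnegative optional pairs $(x^i,c^i)$ with cost $E[\int_0^\infty\psi_x(t)x^i(t)dt+r\int_0^\infty\psi_c(t)c^i(t)dt]$, payoff $E[\int_0^\infty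 e^{-rt}u(x^i(t),c(t))dt]$, $c=\sum_jc^j$. The social planner (weights $1/n$, total cost at most $nw_o$) and the Nash equilibrium (individual cost at most $w_o$) are defined analogously: the planner maximizes the average payoff, and in equilibrium each agent best-replies to $c^{-i}=\sum_{j\ne i}c^j$. $c_*$ is the planner's optimal aggregate contribution and $\hat c$ the aggregate contribution in the symmetric Nash equilibrium. *)

theory Defs
  imports "HOL-Probability.Probability"
begin

text \<open>
  Time is \<^typ>\<open>real\<close>; only \<open>t \<ge> 0\<close> is economically meaningful, and processes are never
  evaluated at negative times. Filtrations are indexed by \<^typ>\<open>real\<close> in order to reuse the library
  locale \<^locale>\<open>filtration\<close>; a filtration on \<open>[0, \<infinity>)\<close> extends to negative indices by \<open>F 0\<close>.
\<close>

type_synonym 'a process = "real \<Rightarrow> 'a \<Rightarrow> real"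

subsection \<open>Stochastic basis\<close>

definition usual_conditions :: "'a measure \<Rightarrow> (real \<Rightarrow> 'a measure) \<Rightarrow> bool" where
  "usual_conditions M F \<longleftrightarrow>
     prob_space M \<and> complete_measure M \<and>
     filtration (space M) F \<and> (\<forall>t\<ge>0. subalgebra M (F t)) \<and>
     null_sets M \<subseteq> sets (F 0) \<and>
     (\<forall>t\<ge>0. sets (F t) = (\<Inter>s\<in>{t<..}. sets (F s)))"

definition adapted :: "(real \<Rightarrow> 'a measure) \<Rightarrow> 'a process \<Rightarrow> bool" where
  "adapted F X \<longleftrightarrow> (\<forall>t\<ge>0. X t \<in> borel_measurable (F t))"

definition cadlag :: "(real \<Rightarrow> real) \<Rightarrow> bool" where
  "cadlag f \<longleftrightarrow> (\<forall>t\<ge>0. continuous (at_right t) f) \<and> (\<forall>t>0. \<exists>l. (f \<longlongrightarrow> l) (at_left t))"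

definition optional_algebra :: "'a measure \<Rightarrow> (real \<Rightarrow> 'a measure) \<Rightarrow> (real \<times> 'a) measure" where
  "optional_algebra M F =
     sigma ({0..} \<times> space M)
       {{(t, \<omega>). t \<ge> 0 \<and> \<omega> \<in> space M \<and> X t \<omega> \<in> B} | X B.
          adapted F X \<and> (\<forall>\<omega>\<in>space M. cadlag (\<lambda>t. X t \<omega>)) \<and> B \<in> sets borel}"

definition optional_process :: "'a measure \<Rightarrow> (real \<Rightarrow> 'a measure) \<Rightarrow> 'a process \<Rightarrow> bool" where
  "optional_process M F X \<longleftrightarrow> (\<lambda>(t, \<omega>). X t \<omega>) \<in> borel_measurable (optional_algebra M F)"

definition brownian_motion :: "'a measure \<Rightarrow> (real \<Rightarrow> 'a measure) \<Rightarrow> 'a process \<Rightarrow> bool" where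
  "brownian_motion M F W \<longleftrightarrow>
     adapted F W \<and>
     (\<forall>\<omega>\<in>space M. continuous_on {0..} (\<lambda>t. W t \<omega>)) \<and>
     (AE \<omega> in M. W 0 \<omega> = 0) \<and>
     (\<forall>s\<ge>0. \<forall>t>s.
        prob_space.indep_set M (sets (F s))
          (sets (vimage_algebra (space M) (\<lambda>\<omega>. W t \<omega> - W s \<omega>) borel)) \<and>
        distributed M lborel (\<lambda>\<omega>. W t \<omega> - W s \<omega>) (normal_density 0 (sqrt (t - s))))"

subsection \<open>Preferences and aggregation\<close>

definition cobb_douglas :: "real \<Rightarrow> real \<Rightarrow> real \<Rightarrow> real \<Rightarrow> real" where
  "cobb_douglas \<alpha> \<beta> x c = x powr \<alpha> * c powr \<beta> / (\<alpha> + \<beta>)"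

definition payoff ::
  "'a measure \<Rightarrow> real \<Rightarrow> (real \<Rightarrow> real \<Rightarrow> real) \<Rightarrow> 'a process \<Rightarrow> 'a process \<Rightarrow> ennreal" where
  "payoff M r u x C =
     (\<integral>\<^sup>+\<omega>. (\<integral>\<^sup>+t\<in>{0..}. ennreal (exp (- r * t) * u (x t \<omega>) (C t \<omega>)) \<partial>lborel) \<partial>M)"

definition aggregate :: "nat \<Rightarrow> (nat \<Rightarrow> 'a process) \<Rightarrow> 'a process" where
  "aggregate n C t \<omega> = (\<Sum>i<n. C i t \<omega>)"

definition aggregate_others :: "nat \<Rightarrow> (nat \<Rightarrow> 'a process) \<Rightarrow> nat \<Rightarrow> 'a process" where
  "aggregate_others n C i t \<omega> = (\<Sum>j\<in>{..<n} - {i}. C j t \<omega>)"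

subsection \<open>Strategies and their costs\<close>

definition irreversible_strategy ::
  "'a measure \<Rightarrow> (real \<Rightarrow> 'a measure) \<Rightarrow> 'a process \<Rightarrow> 'a process \<Rightarrow> bool" where
  "irreversible_strategy M F x C \<longleftrightarrow>
     optional_process M F x \<and> optional_process M F C \<and>
     (\<forall>\<omega>\<in>space M.
        (\<forall>t\<ge>0. 0 \<le> x t \<omega> \<and> 0 \<le> C t \<omega>) \<and>
        mono_on {0..} (\<lambda>t. C t \<omega>) \<and>
        (\<forall>t\<ge>0. continuous (at_right t) (\<lambda>s. C s \<omega>)))"

definition reversible_strategy ::
  "'a measure \<Rightarrow> (real \<Rightarrow> 'a measure) \<Rightarrow> 'a process \<Rightarrow> 'a process \<Rightarrow> bool" where
  "reversible_strategy M F x c \<longleftrightarrow>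
     optional_process M F x \<and> optional_process M F c \<and>
     (\<forall>\<omega>\<in>space M. \<forall>t\<ge>0. 0 \<le> x t \<omega> \<and> 0 \<le> c t \<omega>)"

text \<open>
  Extending the path by \<open>0\<close> to negative times encodes \<open>C(0-) = 0\<close>, so that the Stieltjes measure
  has the point mass \<open>C(0)\<close> at \<open>0\<close>.
\<close>
definition stieltjes :: "(real \<Rightarrow> real) \<Rightarrow> real measure" where
  "stieltjes f = interval_measure (\<lambda>t. if t < 0 then 0 else f t)"

definition irreversible_cost ::
  "'a measure \<Rightarrow> 'a process \<Rightarrow> 'a process \<Rightarrow> 'a process \<Rightarrow> 'a process \<Rightarrow> ennreal" where
  "irreversible_cost M \<psi>\<^sub>x \<psi>\<^sub>c x C =
     (\<integral>\<^sup>+\<omega>. (\<integral>\<^sup>+t\<in>{0..}. ennreal (\<psi>\<^sub>x t \<omega> * x t \<omega>) \<partial>lborel)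
          + (\<integral>\<^sup>+t\<in>{0..}. ennreal (\<psi>\<^sub>c t \<omega>) \<partial>stieltjes (\<lambda>s. C s \<omega>)) \<partial>M)"

definition reversible_cost ::
  "'a measure \<Rightarrow> real \<Rightarrow> 'a process \<Rightarrow> 'a process \<Rightarrow> 'a process \<Rightarrow> 'a process \<Rightarrow> ennreal" where
  "reversible_cost M r \<psi>\<^sub>x \<psi>\<^sub>c x c =
     (\<integral>\<^sup>+\<omega>. (\<integral>\<^sup>+t\<in>{0..}. ennreal (\<psi>\<^sub>x t \<omega> * x t \<omega>) \<partial>lborel)
          + ennreal r * (\<integral>\<^sup>+t\<in>{0..}. ennreal (\<psi>\<^sub>c t \<omega> * c t \<omega>) \<partial>lborel) \<partial>M)"

subsection \<open>Social optimum and Nash equilibrium\<close>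

text \<open>
  \<open>S x C\<close> is the set of individual strategies, \<open>\<Psi> x C\<close> their cost, \<open>U x C\<close> an individual's payoff
  from private consumption \<open>x\<close> and aggregate contribution \<open>C\<close>, and \<open>w\<close> the individual wealth.
\<close>

definition planner_feasible ::
  "('a process \<Rightarrow> 'a process \<Rightarrow> bool) \<Rightarrow> ('a process \<Rightarrow> 'a process \<Rightarrow> ennreal) \<Rightarrow>
   nat \<Rightarrow> real \<Rightarrow> (nat \<Rightarrow> 'a process) \<Rightarrow> (nat \<Rightarrow> 'a process) \<Rightarrow> bool" where
  "planner_feasible S \<Psi> n w x C \<longleftrightarrow>
     (\<forall>i<n. S (x i) (C i)) \<and> (\<Sum>i<n. \<Psi> (x i) (C i)) \<le> ennreal (real n * w)"

definition average_payoff ::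
  "('a process \<Rightarrow> 'a process \<Rightarrow> ennreal) \<Rightarrow> nat \<Rightarrow>
   (nat \<Rightarrow> 'a process) \<Rightarrow> (nat \<Rightarrow> 'a process) \<Rightarrow> ennreal" where
  "average_payoff U n x C = (\<Sum>i<n. ennreal (1 / real n) * U (x i) (aggregate n C))"

definition planner_optimum ::
  "('a process \<Rightarrow> 'a process \<Rightarrow> bool) \<Rightarrow> ('a process \<Rightarrow> 'a process \<Rightarrow> ennreal) \<Rightarrow>
   ('a process \<Rightarrow> 'a process \<Rightarrow> ennreal) \<Rightarrow> nat \<Rightarrow> real \<Rightarrow>
   (nat \<Rightarrow> 'a process) \<Rightarrow> (nat \<Rightarrow> 'a process) \<Rightarrow> bool" where
  "planner_optimum S \<Psi> U n w x C \<longleftrightarrow>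
     planner_feasible S \<Psi> n w x C \<and>
     (\<forall>x' C'. planner_feasible S \<Psi> n w x' C' \<longrightarrow>
        average_payoff U n x' C' \<le> average_payoff U n x C)"

definition nash_equilibrium ::
  "('a process \<Rightarrow> 'a process \<Rightarrow> bool) \<Rightarrow> ('a process \<Rightarrow> 'a process \<Rightarrow> ennreal) \<Rightarrow>
   ('a process \<Rightarrow> 'a process \<Rightarrow> ennreal) \<Rightarrow> nat \<Rightarrow> real \<Rightarrow>
   (nat \<Rightarrow> 'a process) \<Rightarrow> (nat \<Rightarrow> 'a process) \<Rightarrow> bool" where
  "nash_equilibrium S \<Psi> U n w x C \<longleftrightarrow>
     (\<forall>i<n. S (x i) (C i) \<and> \<Psi> (x i) (C i) \<le> ennreal w \<and>
        (\<forall>x' C'. S x' C' \<and> \<Psi> x' C' \<le> ennreal w \<longrightarrow>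
           U x' (\<lambda>t \<omega>. aggregate_others n C i t \<omega> + C' t \<omega>) \<le> U (x i) (aggregate n C)))"

definition symmetric_profile ::
  "'a measure \<Rightarrow> nat \<Rightarrow> (nat \<Rightarrow> 'a process) \<Rightarrow> (nat \<Rightarrow> 'a process) \<Rightarrow> bool" where
  "symmetric_profile M n x C \<longleftrightarrow>
     (\<forall>i<n. \<forall>j<n. \<forall>t\<ge>0. \<forall>\<omega>\<in>space M. x i t \<omega> = x j t \<omega> \<and> C i t \<omega> = C j t \<omega>)"

end

theory Submission
  imports Defs
begin

text \<open>
  Since \<open>exp (- r * t)\<close> is the integral of \<open>r * exp (- r * s)\<close> over \<open>s \<ge> t\<close>, Tonelli's theorem shows
  that an irreversible contribution path costs exactly as much as the same path in the reversible
  economy. The two economies therefore differ only in the convex cone of admissible paths, and one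
  argument covers both. In a symmetric equilibrium, the variational inequality for a single agent
  holds on the whole cone, with the aggregate \<open>n * D\<close> in the marginal utilities. By homogeneity of
  the Cobb-Douglas utility, dividing equilibrium consumption by \<open>n * b\<close> and the aggregate by \<open>b\<close>, with
  \<open>b = (\<alpha> + \<beta>) / (n * \<alpha> + \<beta>)\<close>, turns this into the planner's variational inequality, and the
  rescaled bundle just exhausts his budget. Hence it is optimal, and by the equality case of the
  weighted AM-GM inequality every optimum has this aggregate almost everywhere. The ratio is thus
  the constant \<open>b \<le> 1\<close> in both economies. Brownian motion enters only through the finiteness of
  payoffs, which is where the lower bound on \<open>r\<close> is needed.
\<close>

subsection \<open>Cobb-Douglas utility\<close>

text \<open>With elasticities \<alpha> and \<beta> / n, a single agent spends the fractions n *
  \<alpha> / (n * \<alpha> + \<beta>) and \<beta> / (n * \<alpha> + \<beta>) of wealth on the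
  private and the public good; the planner's fractions are \<alpha> / (\<alpha> + \<beta>) and
  \<beta> / (\<alpha> + \<beta>). The quotient of the public fractions is b and that of the private
  ones is n * b, which is the origin of the two scaling factors. The obstacle is the irreversible
  cone: a path cannot be lowered locally, so no pointwise first-order condition is at hand, and
  optimality has to be used as an integrated inequality tested against members of the cone. Since
  the two scaling factors differ, the cost of the rescaled bundle is not a multiple of the cost of
  the equilibrium bundle. Private and public expenditure have to be identified separately, by
  testing the inequality with the two components of the equilibrium itself. Integrals take extended
  nonnegative values, so a term may be cancelled only once it is known to be finite, and differences
  are arranged to be nonnegative before they are integrated.\<close>

lemma powr_mult_powr_less_affine:
  fixes \<alpha> \<beta> s t :: real
  assumes "0 < \<alpha>" "0 < \<beta>" "\<alpha> + \<beta> < 1" "0 \<le> s" "0 \<le> t" "s \<noteq> 1 \<or> t \<noteq> 1"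
  shows "s powr \<alpha> * t powr \<beta> < (1 - \<alpha> - \<beta>) + \<alpha> * s + \<beta> * t"
proof (cases "s = 0 \<or> t = 0")
  case True
  have "0 \<le> \<alpha> * s" "0 \<le> \<beta> * t" using assms by simp_all
  moreover have "s powr \<alpha> * t powr \<beta> = 0" using True by auto
  ultimately show ?thesis using assms by linarith
next
  case False
  then have st: "0 < s" "0 < t" using assms by auto
  \<comment> \<open>\<open>A\<close> is the arithmetic mean of \<open>s\<close>, \<open>t\<close>
    and 1 with weights \<alpha>, \<beta> and 1 - \<alpha> - \<beta>. After division by
    \<open>A\<close> the right-hand sides of the three bounds ln z \<le> z - 1, so weighted, add up
    to 0. The third entry 1 is what forces both \<open>s\<close> and \<open>t\<close> to be 1 in the
    equality case.\<close>
  define A where "A = (1 - \<alpha> - \<beta>) + \<alpha> * s + \<beta> * t"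
  have "0 < \<alpha> * s" "0 < \<beta> * t" using assms st by simp_all
  then have A: "0 < A" using assms unfolding A_def by linarith
  have ln: "ln (s / A) \<le> s / A - 1" "ln (t / A) \<le> t / A - 1" "ln (1 / A) \<le> 1 / A - 1"
    using A st by (intro ln_le_minus_one; simp)+
  have ne: "s / A \<noteq> 1 \<or> t / A \<noteq> 1"
  proof (rule ccontr)
    assume "\<not> ?thesis"
    then have "s = A" "t = A" using A by auto
    then have "(1 - \<alpha> - \<beta>) * (A - 1) = A - ((1 - \<alpha> - \<beta>) + \<alpha> * s + \<beta> * t)"
      by (simp add: algebra_simps)
    also have "\<dots> = 0" by (simp add: A_def)
    finally have "A = 1" using assms by simp
    then show False using \<open>s = A\<close> \<open>t = A\<close> assms by auto
  qed
  have "\<alpha> * ln (s / A) + \<beta> * ln (t / A) < \<alpha> * (s / A - 1) + \<beta> * (t / A - 1)"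
  proof (cases "s / A = 1")
    case True
    then have "ln (t / A) < t / A - 1"
      using ln ne A st ln_eq_minus_one[of "t / A"] by force
    then show ?thesis using True assms by simp
  next
    case False
    then have "ln (s / A) < s / A - 1"
      using ln A st ln_eq_minus_one[of "s / A"] by force
    then show ?thesis using ln assms
      by (intro add_less_le_mono mult_left_mono mult_strict_left_mono) auto
  qed
  moreover have "(1 - \<alpha> - \<beta>) * ln (1 / A) \<le> (1 - \<alpha> - \<beta>) * (1 / A - 1)"
    using ln assms by (intro mult_left_mono) auto
  moreover have "\<alpha> * (s / A) + \<beta> * (t / A) + (1 - \<alpha> - \<beta>) * (1 / A) = 1"
  proof -
    have "\<alpha> * (s / A) + \<beta> * (t / A) + (1 - \<alpha> - \<beta>) * (1 / A) =
        (\<alpha> * s + \<beta> * t + (1 - \<alpha> - \<beta>)) / A"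
      by (simp add: add_divide_distrib)
    also have "\<alpha> * s + \<beta> * t + (1 - \<alpha> - \<beta>) = A" by (simp add: A_def)
    finally show ?thesis using A by simp
  qed
  ultimately have "\<alpha> * ln (s / A) + \<beta> * ln (t / A) + (1 - \<alpha> - \<beta>) * ln (1 / A) < 0"
    by (simp add: right_diff_distrib)
  then have "\<alpha> * ln s + \<beta> * ln t < ln A"
    using A st by (simp add: ln_div algebra_simps)
  then have "exp (\<alpha> * ln s + \<beta> * ln t) < exp (ln A)" by simp
  then show ?thesis using A st by (simp add: exp_add powr_def A_def)
qed

lemma powr_mult_powr_le_affine:
  fixes \<alpha> \<beta> s t :: real
  assumes "0 < \<alpha>" "0 < \<beta>" "\<alpha> + \<beta> < 1" "0 \<le> s" "0 \<le> t"
  shows "s powr \<alpha> * t powr \<beta> \<le> (1 - \<alpha> - \<beta>) + \<alpha> * s + \<beta> * t"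
proof (cases "s \<noteq> 1 \<or> t \<noteq> 1")
  case True
  then show ?thesis using powr_mult_powr_less_affine[OF assms] by simp
qed simp

lemma cobb_douglas_nonneg: "0 < \<alpha> \<Longrightarrow> 0 < \<beta> \<Longrightarrow> 0 \<le> cobb_douglas \<alpha> \<beta> x c"
  by (simp add: cobb_douglas_def)

lemma cobb_douglas_pos: "0 < \<alpha> \<Longrightarrow> 0 < \<beta> \<Longrightarrow> 0 < x \<Longrightarrow> 0 < c \<Longrightarrow> 0 < cobb_douglas \<alpha> \<beta> x c"
  by (simp add: cobb_douglas_def)

lemma cobb_douglas_mono:
  assumes "0 < \<alpha>" "0 < \<beta>" "0 \<le> x" "x \<le> y" "0 \<le> c" "c \<le> d"
  shows "cobb_douglas \<alpha> \<beta> x c \<le> cobb_douglas \<alpha> \<beta> y d"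
  unfolding cobb_douglas_def using assms
  by (intro divide_right_mono mult_mono powr_mono2) auto

lemma cobb_douglas_mult:
  assumes "0 \<le> a" "0 \<le> b" "0 \<le> x" "0 \<le> c"
  shows "cobb_douglas \<alpha> \<beta> (a * x) (b * c) = a powr \<alpha> * b powr \<beta> * cobb_douglas \<alpha> \<beta> x c"
  using assms by (simp add: cobb_douglas_def powr_mult)

lemma measurable_cobb_douglas [measurable (raw)]:
  assumes [measurable]: "f \<in> borel_measurable N" "g \<in> borel_measurable N"
  shows "(\<lambda>z. cobb_douglas \<alpha> \<beta> (f z) (g z)) \<in> borel_measurable N"
  unfolding cobb_douglas_def by measurable

section \<open>Arithmetic of extended nonnegative integrals, and a difference quotient\<close>

lemma nn_integral_linear_combination:
  fixes f g :: "'b \<Rightarrow> real"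
  assumes [measurable]: "f \<in> borel_measurable N" "g \<in> borel_measurable N"
    and "0 \<le> a" "0 \<le> b" "\<And>z. z \<in> space N \<Longrightarrow> 0 \<le> f z" "\<And>z. z \<in> space N \<Longrightarrow> 0 \<le> g z"
  shows "(\<integral>\<^sup>+z. ennreal (a * f z + b * g z) \<partial>N) =
    ennreal a * (\<integral>\<^sup>+z. ennreal (f z) \<partial>N) + ennreal b * (\<integral>\<^sup>+z. ennreal (g z) \<partial>N)"
proof -
  have "(\<integral>\<^sup>+z. ennreal (a * f z + b * g z) \<partial>N) =
      (\<integral>\<^sup>+z. ennreal a * ennreal (f z) + ennreal b * ennreal (g z) \<partial>N)"
    using assms by (intro nn_integral_cong) (simp add: ennreal_mult')
  also have "\<dots> = (\<integral>\<^sup>+z. ennreal a * ennreal (f z) \<partial>N) + (\<integral>\<^sup>+z. ennreal b * ennreal (g z) \<partial>N)"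
    by (rule nn_integral_add) measurable
  finally show ?thesis by (simp add: nn_integral_cmult)
qed

lemma ennreal_convex_combination:
  assumes "0 \<le> e" "e \<le> 1" "0 \<le> v"
  shows "ennreal (1 - e) * ennreal v + ennreal (e * v) = ennreal v"
proof -
  have "ennreal (1 - e) * ennreal v + ennreal (e * v) = ennreal ((1 - e) * v + e * v)"
    using assms by (simp add: ennreal_mult')
  then show ?thesis by (simp add: algebra_simps)
qed

text \<open>Cancels the finite part (1 - e) * v and divides by e. It replaces the subtraction in
  "the gain of a deviation, divided by its size, is bounded".\<close>

lemma ennreal_perspective_le:
  assumes "0 < e" "e < 1" "0 \<le> v" "ennreal (1 - e) * ennreal v + ennreal e * G \<le> ennreal v"
  shows "G \<le> ennreal v"
proof -
  have "ennreal (1 - e) * ennreal v + ennreal e * G \<le> ennreal (1 - e) * ennreal v + ennreal (e * v)"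
    using assms ennreal_convex_combination[of e v] by simp
  then have "ennreal e * G \<le> ennreal e * ennreal v"
    using assms(1) by (subst (asm) ennreal_add_left_cancel_le) (auto simp: ennreal_mult_eq_top_iff ennreal_mult')
  then show ?thesis using assms(1) by (subst (asm) ennreal_mult_le_mult_iff) auto
qed

lemma ennreal_linear_combination:
  "0 \<le> a \<Longrightarrow> 0 \<le> b \<Longrightarrow> 0 \<le> x \<Longrightarrow> 0 \<le> y \<Longrightarrow>
    ennreal a * ennreal x + ennreal b * ennreal y = ennreal (a * x + b * y)"
  by (simp add: ennreal_mult')

text \<open>This is the directional derivative at (1, 1). It is stated along a sequence because
  Fatou's lemma will be applied to these quotients.\<close>

lemma powr_product_difference_quotient:
  fixes \<alpha> \<beta> a b :: real and e :: "nat \<Rightarrow> real"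
  assumes "filterlim e (at 0) sequentially"
  shows "(\<lambda>k. ((1 + e k * a) powr \<alpha> * (1 + e k * b) powr \<beta> - 1) / e k) \<longlonglongrightarrow> \<alpha> * a + \<beta> * b"
proof -
  define f where "f = (\<lambda>h. (1 + h * a) powr \<alpha> * (1 + h * b) powr \<beta>)"
  have d: "((\<lambda>h. (1 + h * c) powr \<gamma>) has_real_derivative \<gamma> * c) (at 0)" for c \<gamma> :: real
  proof -
    have "((\<lambda>h. 1 + h * c) has_real_derivative c) (at 0)"
      by (auto intro!: derivative_eq_intros)
    from DERIV_fun_powr[OF this, of \<gamma>] show ?thesis by simp
  qed
  have "(f has_real_derivative \<alpha> * a + \<beta> * b) (at 0)"
    using DERIV_mult[OF d[of a \<alpha>] d[of b \<beta>]] unfolding f_def by (simp add: add.commute)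
  then have "((\<lambda>h. (f (0 + h) - f 0) / h) \<longlongrightarrow> \<alpha> * a + \<beta> * b) (at 0)"
    by (simp add: DERIV_def)
  from filterlim_compose[OF this assms] show ?thesis by (simp add: f_def)
qed

text \<open>Turns a lower bound on one share of a capped total into an upper bound on the other; the
  finite number \<open>a\<close> can be cancelled.\<close>

lemma ennreal_share_le:
  assumes "P + Q \<le> ennreal (a + b)" "ennreal a \<le> P" "0 \<le> a" "0 \<le> b"
  shows "Q \<le> ennreal b"
proof -
  have "ennreal a + Q \<le> P + Q" using assms by (intro add_right_mono)
  also have "\<dots> \<le> ennreal a + ennreal b" using assms by simp
  finally show ?thesis by (subst (asm) ennreal_add_left_cancel_le) auto
qed

subsection \<open>Symmetric equilibria and the planner\<close>

text \<open>Abstracts from time and chance: \<open>N\<close> will be space-time with the discounted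
  product measure, \<open>p\<close> and \<open>q\<close> the undiscounted prices, \<open>A\<close>
  the private plans and \<open>B\<close> the contribution paths. The plans only have to form convex
  cones, so that monotone and unrestricted contributions are both instances. \<open>interior\<close>
  feeds the Inada argument, and \<open>payoff_finite\<close> makes the later cancellations
  legitimate.\<close>

locale cobb_douglas_market =
  fixes N :: "'b measure" and A B :: "('b \<Rightarrow> real) set" and p q :: "'b \<Rightarrow> real"
    and \<alpha> \<beta> w :: real
  assumes exponents: "0 < \<alpha>" "0 < \<beta>" "\<alpha> + \<beta> < 1" and wealth: "0 < w"
    and p_measurable [measurable]: "p \<in> borel_measurable N"
    and q_measurable [measurable]: "q \<in> borel_measurable N"
    and p_nonneg: "z \<in> space N \<Longrightarrow> 0 \<le> p z"
    and q_nonneg: "z \<in> space N \<Longrightarrow> 0 \<le> q z"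
    and A_measurable: "f \<in> A \<Longrightarrow> f \<in> borel_measurable N"
    and B_measurable: "f \<in> B \<Longrightarrow> f \<in> borel_measurable N"
    and A_nonneg: "f \<in> A \<Longrightarrow> z \<in> space N \<Longrightarrow> 0 \<le> f z"
    and B_nonneg: "f \<in> B \<Longrightarrow> z \<in> space N \<Longrightarrow> 0 \<le> f z"
    and A_add: "f \<in> A \<Longrightarrow> g \<in> A \<Longrightarrow> (\<lambda>z. f z + g z) \<in> A"
    and B_add: "f \<in> B \<Longrightarrow> g \<in> B \<Longrightarrow> (\<lambda>z. f z + g z) \<in> B"
    and A_scale: "0 \<le> a \<Longrightarrow> f \<in> A \<Longrightarrow> (\<lambda>z. a * f z) \<in> A"
    and B_scale: "0 \<le> a \<Longrightarrow> f \<in> B \<Longrightarrow> (\<lambda>z. a * f z) \<in> B"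
    and interior: "\<exists>f\<in>A. \<exists>g\<in>B. (\<forall>z\<in>space N. 0 < f z \<and> 0 < g z) \<and>
      (\<integral>\<^sup>+z. ennreal (p z * f z + q z * g z) \<partial>N) < \<infinity>"
    and payoff_finite: "f \<in> A \<Longrightarrow> g \<in> B \<Longrightarrow>
      (\<integral>\<^sup>+z. ennreal (p z * f z + q z * g z) \<partial>N) < \<infinity> \<Longrightarrow>
      (\<integral>\<^sup>+z. ennreal (cobb_douglas \<alpha> \<beta> (f z) (g z)) \<partial>N) < \<infinity>"
begin

section \<open>Linearity of expenditure\<close>

definition cost :: "('b \<Rightarrow> real) \<Rightarrow> ('b \<Rightarrow> real) \<Rightarrow> ennreal" where
  "cost x c = (\<integral>\<^sup>+z. ennreal (p z * x z + q z * c z) \<partial>N)"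

definition utility :: "('b \<Rightarrow> real) \<Rightarrow> ('b \<Rightarrow> real) \<Rightarrow> ennreal" where
  "utility x c = (\<integral>\<^sup>+z. ennreal (cobb_douglas \<alpha> \<beta> (x z) (c z)) \<partial>N)"

lemmas nonneg = A_nonneg B_nonneg p_nonneg q_nonneg

lemma cost_add:
  assumes "x \<in> A" "y \<in> A" "c \<in> B" "d \<in> B"
  shows "cost (\<lambda>z. x z + y z) (\<lambda>z. c z + d z) = cost x c + cost y d"
proof -
  note [measurable] = assms(1,2)[THEN A_measurable] assms(3,4)[THEN B_measurable]
  have "cost (\<lambda>z. x z + y z) (\<lambda>z. c z + d z) =
      (\<integral>\<^sup>+z. ennreal (p z * x z + q z * c z) + ennreal (p z * y z + q z * d z) \<partial>N)"
    unfolding cost_def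
  proof (rule nn_integral_cong)
    fix z assume "z \<in> space N"
    then have "0 \<le> p z * x z + q z * c z" "0 \<le> p z * y z + q z * d z"
      using assms by (simp_all add: nonneg)
    moreover have "p z * (x z + y z) + q z * (c z + d z) =
        (p z * x z + q z * c z) + (p z * y z + q z * d z)" by (simp add: algebra_simps)
    ultimately show "ennreal (p z * (x z + y z) + q z * (c z + d z)) =
        ennreal (p z * x z + q z * c z) + ennreal (p z * y z + q z * d z)" by simp
  qed
  also have "\<dots> = cost x c + cost y d"
    unfolding cost_def by (rule nn_integral_add) measurable
  finally show ?thesis .
qed

lemma cost_scale:
  assumes "x \<in> A" "c \<in> B" "0 \<le> a"
  shows "cost (\<lambda>z. a * x z) (\<lambda>z. a * c z) = ennreal a * cost x c"
proof -
  note [measurable] = assms(1)[THEN A_measurable] assms(2)[THEN B_measurable]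
  have "cost (\<lambda>z. a * x z) (\<lambda>z. a * c z) = (\<integral>\<^sup>+z. ennreal a * ennreal (p z * x z + q z * c z) \<partial>N)"
    unfolding cost_def using assms(3)
    by (intro nn_integral_cong) (simp add: ennreal_mult'[symmetric] distrib_left mult.left_commute)
  also have "\<dots> = ennreal a * cost x c"
    unfolding cost_def by (rule nn_integral_cmult) measurable
  finally show ?thesis .
qed

lemma cost_sum:
  fixes n :: nat
  assumes "\<And>i. i < n \<Longrightarrow> x i \<in> A" "\<And>i. i < n \<Longrightarrow> c i \<in> B" "0 < n"
  shows "(\<lambda>z. \<Sum>i<n. x i z) \<in> A \<and> (\<lambda>z. \<Sum>i<n. c i z) \<in> B \<and>
    cost (\<lambda>z. \<Sum>i<n. x i z) (\<lambda>z. \<Sum>i<n. c i z) = (\<Sum>i<n. cost (x i) (c i))"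
  using assms(3,1,2)
proof (induction n rule: nat_induct_non_zero)
  case 1
  then show ?case by simp
next
  case (Suc n)
  then have IH: "(\<lambda>z. \<Sum>i<n. x i z) \<in> A" "(\<lambda>z. \<Sum>i<n. c i z) \<in> B"
    "cost (\<lambda>z. \<Sum>i<n. x i z) (\<lambda>z. \<Sum>i<n. c i z) = (\<Sum>i<n. cost (x i) (c i))"
    and n: "x n \<in> A" "c n \<in> B" by simp_all
  show ?case
    using A_add[OF IH(1) n(1)] B_add[OF IH(2) n(2)] cost_add[OF IH(1) n(1) IH(2) n(2)] IH(3)
    by simp
qed

text \<open>The two components will be rescaled by different factors, so their costs have to be
  accounted for separately. The zero plan lies in each cone as 0 times any member.\<close>

lemma cost_split:
  assumes "x \<in> A" "c \<in> B"
  shows "(\<lambda>_. 0) \<in> A" "(\<lambda>_. 0) \<in> B" "cost x c = cost x (\<lambda>_. 0) + cost (\<lambda>_. 0) c"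
proof -
  show z: "(\<lambda>_. 0) \<in> A" "(\<lambda>_. 0) \<in> B" using A_scale[of 0 x] B_scale[of 0 c] assms by simp_all
  show "cost x c = cost x (\<lambda>_. 0) + cost (\<lambda>_. 0) c"
    using cost_add[OF assms(1) z(1) z(2) assms(2)] by simp
qed

end

text \<open>\<open>X\<close> and \<open>D\<close> are the plan of a representative agent and
  \<open>m\<close> is the number of agents as a real number, so the others contribute (m - 1) * D in
  total, whatever the deviator does.\<close>

locale symmetric_equilibrium = cobb_douglas_market N A B p q \<alpha> \<beta> w
  for N :: "'b measure" and A B :: "('b \<Rightarrow> real) set" and p q :: "'b \<Rightarrow> real"
    and \<alpha> \<beta> w :: real +
  fixes m :: real and X D :: "'b \<Rightarrow> real"
  assumes m: "1 \<le> m" and X: "X \<in> A" and D: "D \<in> B" and budget: "cost X D \<le> ennreal w"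
    and no_deviation: "y \<in> A \<Longrightarrow> E \<in> B \<Longrightarrow> cost y E \<le> ennreal w \<Longrightarrow>
      utility y (\<lambda>z. (m - 1) * D z + E z) \<le> utility X (\<lambda>z. m * D z)"
begin

section \<open>Deviations of one agent and the integrated first-order condition\<close>

lemmas [measurable] = X[THEN A_measurable] D[THEN B_measurable]

definition u where "u z = cobb_douglas \<alpha> \<beta> (X z) (m * D z)"
definition v where "v = enn2real (utility X (\<lambda>z. m * D z))"

lemma u_measurable [measurable]: "u \<in> borel_measurable N"
  unfolding u_def[abs_def] by measurable

lemma u_nonneg: "0 \<le> u z"
  unfolding u_def using exponents by (simp add: cobb_douglas_nonneg)

lemma v_nonneg: "0 \<le> v" by (simp add: v_def)

text \<open>The aggregate m * D exceeds what one agent pays for, but (X, m * D) costs at most m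
  times the individual budget. Hence its utility is finite and \<open>enn2real\<close> loses nothing
  in the definition of \<open>v\<close>.\<close>

lemma utility_eq: "(\<integral>\<^sup>+z. ennreal (u z) \<partial>N) = ennreal v"
proof -
  have mD: "(\<lambda>z. m * D z) \<in> B" using B_scale D m by simp
  have "X z \<le> m * X z" if "z \<in> space N" for z
    using mult_right_mono[OF m A_nonneg[OF X that]] by simp
  then have "cost X (\<lambda>z. m * D z) \<le> cost (\<lambda>z. m * X z) (\<lambda>z. m * D z)"
    unfolding cost_def
    by (intro nn_integral_mono ennreal_leI add_right_mono mult_left_mono p_nonneg)
  also have "\<dots> = ennreal m * cost X D" using m X D by (simp add: cost_scale)
  also have "\<dots> \<le> ennreal m * ennreal w" using budget by (rule mult_left_mono) simp
  also have "\<dots> < \<infinity>" by (simp add: ennreal_mult_less_top)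
  finally have "utility X (\<lambda>z. m * D z) < \<infinity>"
    unfolding utility_def cost_def using payoff_finite[OF X mD] by simp
  then show ?thesis unfolding v_def u_def utility_def by simp
qed

text \<open>A convex combination of two affordable plans is affordable and stays in the cone. The
  direction E - D itself need not belong to the cone, which is why the move is made through such
  combinations.\<close>

lemma deviation:
  assumes "y \<in> A" "E \<in> B" "cost y E \<le> ennreal w" "0 < e" "e < 1"
  shows "(\<integral>\<^sup>+z. ennreal (cobb_douglas \<alpha> \<beta> ((1 - e) * X z + e * y z) (m * D z + e * (E z - D z))) \<partial>N)
    \<le> ennreal v"
proof -
  have "cost (\<lambda>z. (1 - e) * X z + e * y z) (\<lambda>z. (1 - e) * D z + e * E z) =
      ennreal (1 - e) * cost X D + ennreal e * cost y E"
    using assms X D by (subst cost_add) (auto simp: A_scale B_scale cost_scale)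
  also have "\<dots> \<le> ennreal (1 - e) * ennreal w + ennreal e * ennreal w"
    using assms budget by (intro add_mono mult_left_mono) auto
  also have "\<dots> = ennreal w"
    using assms wealth ennreal_convex_combination[of e w] by (simp add: ennreal_mult')
  finally have "utility (\<lambda>z. (1 - e) * X z + e * y z) (\<lambda>z. (m - 1) * D z + ((1 - e) * D z + e * E z))
      \<le> utility X (\<lambda>z. m * D z)"
    using assms X D by (intro no_deviation) (auto intro!: A_add B_add A_scale B_scale)
  also have "\<dots> = ennreal v" using utility_eq unfolding utility_def u_def .
  finally show ?thesis unfolding utility_def by (simp add: algebra_simps)
qed

text \<open>The deviator gives up at most the fraction \<open>e\<close> of \<open>X\<close> and of
  the aggregate, and utility is homogeneous of degree \<alpha> + \<beta> < 1, so at least the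
  fraction 1 - e of utility survives. This is the nonnegativity that makes Fatou's lemma
  applicable.\<close>

lemma deviation_lower:
  assumes "y \<in> A" "E \<in> B" "0 < e" "e < 1" "z \<in> space N"
  shows "(1 - e) * u z \<le>
    cobb_douglas \<alpha> \<beta> ((1 - e) * X z + e * y z) (m * D z + e * (E z - D z))"
proof -
  have nn: "0 \<le> X z" "0 \<le> D z" "0 \<le> y z" "0 \<le> E z" using assms X D by (simp_all add: nonneg)
  have "1 - e = (1 - e) powr 1" using assms by simp
  also have "\<dots> \<le> (1 - e) powr (\<alpha> + \<beta>)"
    using assms exponents by (intro powr_mono') auto
  finally have "(1 - e) * u z \<le> (1 - e) powr (\<alpha> + \<beta>) * u z"
    using u_nonneg by (intro mult_right_mono)
  also have "\<dots> = cobb_douglas \<alpha> \<beta> ((1 - e) * X z) ((1 - e) * (m * D z))"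
    unfolding u_def using assms nn m by (subst cobb_douglas_mult) (auto simp: powr_add)
  also have "\<dots> \<le> cobb_douglas \<alpha> \<beta> ((1 - e) * X z + e * y z) (m * D z + e * (E z - D z))"
  proof (rule cobb_douglas_mono)
    have "e * D z \<le> e * (m * D z)" "0 \<le> e * E z"
      using assms nn mult_right_mono[OF m nn(2)] by (auto intro!: mult_left_mono)
    then show "(1 - e) * (m * D z) \<le> m * D z + e * (E z - D z)"
      by (simp add: algebra_simps)
  qed (use assms nn m exponents in auto)
  finally show ?thesis .
qed

text \<open>Inada condition: moving a fraction \<open>e\<close> of wealth to an interior bundle costs at most \<open>e * v\<close>
  but gains order \<open>e powr (\<alpha> + \<beta>)\<close> wherever equilibrium utility vanishes.\<close>

lemma positive: "AE z in N. 0 < X z \<and> 0 < D z"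
proof -
  obtain f g where fg: "f \<in> A" "g \<in> B" "\<And>z. z \<in> space N \<Longrightarrow> 0 < f z \<and> 0 < g z"
    and fin: "cost f g < \<infinity>"
    using interior unfolding cost_def by blast
  \<comment> \<open>The summand 1 keeps the denominator positive and makes the scaled interior
    bundle affordable.\<close>
  define s where "s = w / (enn2real (cost f g) + 1)"
  have s: "0 < s" using wealth unfolding s_def by (simp add: add_nonneg_pos)
  define y where "y = (\<lambda>z. s * f z)"
  define E where "E = (\<lambda>z. s * g z)"
  have yE: "y \<in> A" "E \<in> B" using fg s by (auto simp: y_def E_def A_scale B_scale)
  note [measurable] = yE(1)[THEN A_measurable] yE(2)[THEN B_measurable]
  have pos: "0 < y z" "0 < E z" if "z \<in> space N" for z using fg(3)[OF that] s by (auto simp: y_def E_def)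
  have "cost y E = ennreal s * ennreal (enn2real (cost f g))"
    using fin fg s by (simp add: y_def E_def cost_scale)
  also have "\<dots> = ennreal (w * (enn2real (cost f g) / (enn2real (cost f g) + 1)))"
    using s by (simp add: ennreal_mult'[symmetric] s_def)
  also have "\<dots> \<le> ennreal (w * 1)"
    using wealth by (intro ennreal_leI mult_left_mono) (auto simp: divide_le_eq add_nonneg_pos)
  also have "\<dots> = ennreal w" by simp
  finally have cost: "cost y E \<le> ennreal w" .
  define Z where "Z = {z \<in> space N. X z = 0 \<or> D z = 0}"
  have [measurable]: "Z \<in> sets N" unfolding Z_def by measurable
  define h where "h = (\<lambda>z. indicator Z z * cobb_douglas \<alpha> \<beta> (y z) (E z))"
  have [measurable]: "h \<in> borel_measurable N" unfolding h_def by measurable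
  have hnn: "0 \<le> h z" for z
    using exponents by (simp add: h_def cobb_douglas_nonneg)
  \<comment> \<open>On \<open>Z\<close> equilibrium utility is 0 and the new bundle dominates (e *
    y, e * E), worth e powr (\<alpha> + \<beta>) times its value at e = 1; off \<open>Z\<close> the
    general lower bound applies. Cancelling (1 - e) * v leaves e * v on the right.\<close>
  have ub: "(\<integral>\<^sup>+z. ennreal (h z) \<partial>N) \<le> ennreal (e powr (1 - \<alpha> - \<beta>) * v)" if e: "0 < e" "e < 1" for e
  proof -
    have "ennreal (1 - e) * ennreal v + ennreal (e powr (\<alpha> + \<beta>)) * (\<integral>\<^sup>+z. ennreal (h z) \<partial>N)
      = (\<integral>\<^sup>+z. ennreal ((1 - e) * u z + e powr (\<alpha> + \<beta>) * h z) \<partial>N)"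
      using e hnn u_nonneg unfolding utility_eq[symmetric]
      by (intro nn_integral_linear_combination[symmetric]) auto
    also have "\<dots> \<le> (\<integral>\<^sup>+z. ennreal (cobb_douglas \<alpha> \<beta> ((1 - e) * X z + e * y z)
      (m * D z + e * (E z - D z))) \<partial>N)"
    proof (intro nn_integral_mono ennreal_leI)
      fix z assume z: "z \<in> space N"
      have nn: "0 \<le> X z" "0 \<le> D z" using z X D by (simp_all add: nonneg)
      show "(1 - e) * u z + e powr (\<alpha> + \<beta>) * h z \<le> cobb_douglas \<alpha> \<beta> ((1 - e) * X z + e * y z)
        (m * D z + e * (E z - D z))"
      proof (cases "z \<in> Z")
        case False
        then show ?thesis using deviation_lower[OF yE e z] by (simp add: h_def)
      next
        case True
        then have "u z = 0" by (auto simp: Z_def u_def cobb_douglas_def)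
        then have "(1 - e) * u z + e powr (\<alpha> + \<beta>) * h z = cobb_douglas \<alpha> \<beta> (e * y z) (e * E z)"
          using True e pos[OF z] by (simp add: h_def cobb_douglas_mult powr_add)
        also have "\<dots> \<le> cobb_douglas \<alpha> \<beta> ((1 - e) * X z + e * y z) (m * D z + e * (E z - D z))"
        proof (rule cobb_douglas_mono)
          have "e * D z \<le> m * D z" using nn m e by (intro mult_right_mono) auto
          then show "e * E z \<le> m * D z + e * (E z - D z)" by (simp add: algebra_simps)
        qed (use exponents pos[OF z] e nn in \<open>auto intro: less_imp_le\<close>)
        finally show ?thesis .
      qed
    qed
    also have "\<dots> \<le> ennreal v" by (rule deviation[OF yE cost e])
    also have "ennreal v = ennreal (1 - e) * ennreal v + ennreal (e * v)"
      using e v_nonneg by (simp only: ennreal_convex_combination less_imp_le)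
    finally have 1: "ennreal (e powr (\<alpha> + \<beta>)) * (\<integral>\<^sup>+z. ennreal (h z) \<partial>N) \<le> ennreal (e * v)"
      by (subst (asm) ennreal_add_left_cancel_le) (auto simp: ennreal_mult_eq_top_iff)
    have "e * v = e powr (\<alpha> + \<beta>) * (e powr (1 - \<alpha> - \<beta>) * v)"
      using e by (simp flip: powr_add mult.assoc)
    with 1 have "ennreal (e powr (\<alpha> + \<beta>)) * (\<integral>\<^sup>+z. ennreal (h z) \<partial>N) \<le>
        ennreal (e powr (\<alpha> + \<beta>)) * ennreal (e powr (1 - \<alpha> - \<beta>) * v)"
      by (simp only: ennreal_mult' powr_ge_zero)
    then show ?thesis using e by (subst (asm) ennreal_mult_le_mult_iff) auto
  qed
  \<comment> \<open>The exponent 1 - \<alpha> - \<beta> is positive, so the bound vanishes as e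
    tends to 0 and \<open>h\<close> integrates to 0.\<close>
  have "((\<lambda>e. e powr (1 - \<alpha> - \<beta>)) \<longlongrightarrow> 0) (at_right 0)"
    using exponents
    by (intro tendsto_zero_powrI[OF tendsto_ident_at tendsto_const] eventually_at_rightI[of 0 1]) auto
  from tendsto_ennrealI[OF tendsto_mult[OF this tendsto_const[of v]]]
  have "((\<lambda>e. ennreal (e powr (1 - \<alpha> - \<beta>) * v)) \<longlongrightarrow> 0) (at_right 0)"
    by simp
  moreover have "eventually (\<lambda>e. (\<integral>\<^sup>+z. ennreal (h z) \<partial>N) \<le> ennreal (e powr (1 - \<alpha> - \<beta>) * v)) (at_right 0)"
    using ub by (intro eventually_at_rightI[of 0 1]) auto
  ultimately have "(\<integral>\<^sup>+z. ennreal (h z) \<partial>N) \<le> 0"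
    by (rule tendsto_lowerbound) simp
  then have "(\<integral>\<^sup>+z. ennreal (h z) \<partial>N) = 0" by simp
  then have "AE z in N. ennreal (h z) = 0" by (subst (asm) nn_integral_0_iff_AE) auto
  with AE_space show ?thesis
  proof eventually_elim
    case (elim z)
    have "z \<notin> Z"
    proof
      assume "z \<in> Z"
      then have "h z = cobb_douglas \<alpha> \<beta> (y z) (E z)" by (simp add: h_def)
      moreover have "0 < cobb_douglas \<alpha> \<beta> (y z) (E z)"
        using exponents pos elim by (intro cobb_douglas_pos) auto
      ultimately show False using elim hnn[of z] by simp
    qed
    then show ?case using elim A_nonneg[OF X, of z] B_nonneg[OF D, of z] by (auto simp: Z_def)
  qed
qed

text \<open>Only one of the \<open>m\<close> agents deviates, so his contribution enters with elasticity \<open>\<beta> / m\<close>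
  instead of \<open>\<beta>\<close>: this is the source of free-riding.\<close>

definition marginal :: "('b \<Rightarrow> real) \<Rightarrow> ('b \<Rightarrow> real) \<Rightarrow> 'b \<Rightarrow> real" where
  "marginal y E z = u z * (\<alpha> * (y z / X z) + \<beta> / m * (E z / D z))"

lemma marginal_measurable [measurable (raw)]:
  assumes [measurable]: "y \<in> borel_measurable N" "E \<in> borel_measurable N"
  shows "marginal y E \<in> borel_measurable N"
  unfolding marginal_def[abs_def] by measurable

lemma marginal_nonneg:
  assumes "y \<in> A" "E \<in> B" "z \<in> space N"
  shows "0 \<le> marginal y E z"
proof -
  have "0 \<le> X z" "0 \<le> D z" "0 \<le> y z" "0 \<le> E z" using assms X D by (simp_all add: nonneg)
  then show ?thesis using exponents m u_nonneg by (simp add: marginal_def)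
qed

lemma elasticity: "0 < \<alpha> + \<beta> / m" "\<alpha> + \<beta> / m < 1"
proof -
  have "0 < \<beta> / m" "\<beta> / m \<le> \<beta>" using exponents m by (simp_all add: divide_le_eq mult_le_cancel_left1)
  then show "0 < \<alpha> + \<beta> / m" "\<alpha> + \<beta> / m < 1" using exponents by linarith+
qed

text \<open>Fatou's lemma replaces differentiation under the integral sign: no integrable majorant
  of the difference quotients is required, only their nonnegativity and the bound \<open>v\<close>
  on their integrals.\<close>

lemma first_order_condition:
  assumes yE: "y \<in> A" "E \<in> B" and cost: "cost y E \<le> ennreal w"
  shows "(\<integral>\<^sup>+z. ennreal (marginal y E z) \<partial>N) \<le> ennreal ((\<alpha> + \<beta> / m) * v)"
proof -
  note [measurable] = yE(1)[THEN A_measurable] yE(2)[THEN B_measurable]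
  \<comment> \<open>The offset 2 gives e k < 1 already for k = 0.\<close>
  define e :: "nat \<Rightarrow> real" where "e k = 1 / real (k + 2)" for k
  have e: "0 < e k" "e k < 1" for k by (simp_all add: e_def)
  have "e \<longlonglongrightarrow> 0" unfolding e_def by (rule LIMSEQ_ignore_initial_segment[OF lim_1_over_n])
  then have e0: "filterlim e (at 0) sequentially"
    using e by (simp add: filterlim_at less_imp_neq[symmetric])
  define U where "U k z = cobb_douglas \<alpha> \<beta> ((1 - e k) * X z + e k * y z) (m * D z + e k * (E z - D z))" for k z
  \<comment> \<open>Measured from (1 - e) * u instead of \<open>u\<close>, the quotient is
    nonnegative. It equals the usual difference quotient plus \<open>u\<close>, which accounts for
    the extra multiple of \<open>u\<close> in the limit.\<close>
  define g where "g k z = (U k z - (1 - e k) * u z) / e k" for k z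
  have [measurable]: "g k \<in> borel_measurable N" for k unfolding g_def[abs_def] U_def by measurable
  have gnn: "0 \<le> g k z" if "z \<in> space N" for k z
    using deviation_lower[OF yE e that] e[of k] by (simp add: g_def U_def)
  have gv: "(\<integral>\<^sup>+z. ennreal (g k z) \<partial>N) \<le> ennreal v" for k
  proof (rule ennreal_perspective_le[OF e v_nonneg])
    have "U k z = (1 - e k) * u z + e k * g k z" for z using e[of k] by (simp add: g_def)
    then have "(\<integral>\<^sup>+z. ennreal (U k z) \<partial>N) = ennreal (1 - e k) * ennreal v + ennreal (e k) * (\<integral>\<^sup>+z. ennreal (g k z) \<partial>N)"
      using e[of k] u_nonneg gnn unfolding utility_eq[symmetric]
      by (subst nn_integral_linear_combination[symmetric]) auto
    then show "ennreal (1 - e k) * ennreal v + ennreal (e k) * (\<integral>\<^sup>+z. ennreal (g k z) \<partial>N) \<le> ennreal v"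
      using deviation[OF yE cost e(1)[of k] e(2)[of k]] unfolding U_def by simp
  qed
  have lim: "AE z in N. (\<lambda>k. ennreal (g k z)) \<longlonglongrightarrow> ennreal (1 * marginal y E z + (1 - (\<alpha> + \<beta> / m)) * u z)"
    using positive AE_space
  proof eventually_elim
    case (elim z)
    \<comment> \<open>Relative directions: \<open>a\<close> is the relative change of private
      consumption per unit of \<open>e\<close>, and \<open>b\<close> that of the aggregate m * D.
      The divisor \<open>m\<close> in \<open>b\<close> is the source of the elasticity \<beta> /
      m.\<close>
    define a where "a = y z / X z - 1"
    define b where "b = (E z / D z - 1) / m"
    have "U k z = u z * ((1 + e k * a) powr \<alpha> * (1 + e k * b) powr \<beta>)" for k
    proof -
      have nn: "0 \<le> y z" "0 \<le> E z" using yE elim by (simp_all add: nonneg)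
      have 1: "(1 - e k) * X z + e k * y z = (1 + e k * a) * X z"
        using elim by (simp add: a_def field_simps)
      have 2: "m * D z + e k * (E z - D z) = (1 + e k * b) * (m * D z)"
        using elim m by (simp add: b_def field_simps)
      have "0 \<le> (1 - e k) * X z + e k * y z" using elim nn e[of k] by simp
      then have 3: "0 \<le> 1 + e k * a" unfolding 1 using elim by (simp add: zero_le_mult_iff)
      have "e k * D z \<le> m * D z" using elim e[of k] m by (intro mult_right_mono) auto
      then have "0 \<le> m * D z + e k * (E z - D z)"
        using mult_nonneg_nonneg[of "e k" "E z"] nn e[of k] unfolding right_diff_distrib by linarith
      moreover have "0 < m * D z" using elim m by simp
      ultimately have 4: "0 \<le> 1 + e k * b" unfolding 2 by (simp add: zero_le_mult_iff)
      show ?thesis unfolding U_def 1 2 u_def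
        using 3 4 elim m by (subst cobb_douglas_mult) auto
    qed
    then have "g k z = u z * (((1 + e k * a) powr \<alpha> * (1 + e k * b) powr \<beta> - 1) / e k + 1)" for k
      using e[of k] by (simp add: g_def field_simps)
    then have "(\<lambda>k. g k z) \<longlonglongrightarrow> u z * (\<alpha> * a + \<beta> * b + 1)"
      by (auto intro!: tendsto_intros powr_product_difference_quotient e0)
    also have "u z * (\<alpha> * a + \<beta> * b + 1) = 1 * marginal y E z + (1 - (\<alpha> + \<beta> / m)) * u z"
      by (simp add: marginal_def a_def b_def algebra_simps diff_divide_distrib)
    finally show ?case by (rule tendsto_ennrealI)
  qed
  have "(\<integral>\<^sup>+z. ennreal (marginal y E z) \<partial>N) + ennreal (1 - (\<alpha> + \<beta> / m)) * ennreal v =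
      (\<integral>\<^sup>+z. ennreal (1 * marginal y E z + (1 - (\<alpha> + \<beta> / m)) * u z) \<partial>N)"
    using elasticity u_nonneg marginal_nonneg[OF yE] unfolding utility_eq[symmetric]
    by (subst nn_integral_linear_combination) auto
  also have "\<dots> = (\<integral>\<^sup>+z. liminf (\<lambda>k. ennreal (g k z)) \<partial>N)"
    using lim by (intro nn_integral_cong_AE, eventually_elim) (simp add: lim_imp_Liminf)
  also have "\<dots> \<le> liminf (\<lambda>k. \<integral>\<^sup>+z. ennreal (g k z) \<partial>N)"
    by (rule nn_integral_liminf) measurable
  also have "\<dots> \<le> ennreal v"
    using gv by (intro Liminf_le) auto
  also have "ennreal v = ennreal ((\<alpha> + \<beta> / m) * v) + ennreal (1 - (\<alpha> + \<beta> / m)) * ennreal v"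
    using ennreal_convex_combination[of "\<alpha> + \<beta> / m" v] elasticity v_nonneg by (simp add: add.commute)
  finally show ?thesis
    by (subst (asm) (1 2) add.commute, subst (asm) ennreal_add_left_cancel_le) (auto simp: ennreal_mult_eq_top_iff)
qed

text \<open>\<open>marginal\<close> is linear in the test bundle, so the budget \<open>w\<close> may
  be replaced by any positive multiple of it. The expenditure bounds need test bundles that cost
  less than \<open>w\<close>.\<close>

lemma first_order_condition_scaled:
  assumes yE: "y \<in> A" "E \<in> B" and s: "0 < s" and cost: "cost y E \<le> ennreal (s * w)"
  shows "(\<integral>\<^sup>+z. ennreal (marginal y E z) \<partial>N) \<le> ennreal (s * (\<alpha> + \<beta> / m) * v)"
proof -
  define y' where "y' = (\<lambda>z. 1 / s * y z)"
  define E' where "E' = (\<lambda>z. 1 / s * E z)"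
  have yE': "y' \<in> A" "E' \<in> B" using yE s A_scale[of "1 / s" y] B_scale[of "1 / s" E] by (auto simp: y'_def E'_def)
  note [measurable] = yE'(1)[THEN A_measurable] yE'(2)[THEN B_measurable]
  have "cost y' E' \<le> ennreal (1 / s) * ennreal (s * w)"
    unfolding y'_def E'_def using yE s cost by (subst cost_scale) (auto intro!: mult_left_mono)
  also have "\<dots> = ennreal (1 / s * (s * w))" using s by (intro ennreal_mult'[symmetric]) simp
  also have "\<dots> = ennreal w" using s by simp
  finally have "(\<integral>\<^sup>+z. ennreal (marginal y' E' z) \<partial>N) \<le> ennreal ((\<alpha> + \<beta> / m) * v)"
    by (rule first_order_condition[OF yE'])
  then have "ennreal s * (\<integral>\<^sup>+z. ennreal (marginal y' E' z) \<partial>N) \<le> ennreal s * ennreal ((\<alpha> + \<beta> / m) * v)"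
    by (rule mult_left_mono) simp
  moreover have "(\<integral>\<^sup>+z. ennreal (marginal y E z) \<partial>N) = ennreal s * (\<integral>\<^sup>+z. ennreal (marginal y' E' z) \<partial>N)"
  proof -
    have "marginal y E z = s * marginal y' E' z" for z
      using s by (simp add: marginal_def y'_def E'_def distrib_left mult.left_commute)
    then have "ennreal (marginal y E z) = ennreal s * ennreal (marginal y' E' z)" for z
      using s by (simp add: ennreal_mult')
    then show ?thesis by (simp add: nn_integral_cmult)
  qed
  ultimately show ?thesis using s by (simp add: ennreal_mult' mult.assoc)
qed

text \<open>Utility is positive almost everywhere because \<open>X\<close> and \<open>D\<close> are.
  If it integrates to 0, then \<open>N\<close> is a null measure and every property holds almost
  everywhere.\<close>

lemma AE_if_v_zero:
  assumes "v = 0"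
  shows "AE z in N. Q z"
proof -
  have "AE z in N. ennreal (u z) = 0"
    using utility_eq assms by (subst nn_integral_0_iff_AE[symmetric]) auto
  with positive show ?thesis
  proof eventually_elim
    case (elim z)
    then have "0 < u z" unfolding u_def using exponents m by (intro cobb_douglas_pos) auto
    then show ?case using elim by simp
  qed
qed

text \<open>Euler's relation: the budget shares are the elasticities of utility.\<close>

lemma expenditure_lower:
  assumes v: "0 < v"
  shows "ennreal (\<alpha> * w / (\<alpha> + \<beta> / m)) \<le> cost X (\<lambda>_. 0)"
    and "ennreal (\<beta> / m * w / (\<alpha> + \<beta> / m)) \<le> cost (\<lambda>_. 0) D"
proof -
  \<comment> \<open>A test bundle whose marginal value is the fraction \<open>c\<close> of utility
    cannot be too cheap: scaled up to the budget \<open>w\<close>, it would violate the first-order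
    condition. The two components of the equilibrium are such bundles, with \<open>c\<close> equal
    to \<alpha> and \<beta> / m.\<close>
  have key: "ennreal (c * w / (\<alpha> + \<beta> / m)) \<le> cost y E"
    if yE: "y \<in> A" "E \<in> B" and c: "AE z in N. marginal y E z = c * u z" "0 < c" for y E c
  proof (rule ccontr)
    let ?k = "\<alpha> + \<beta> / m"
    assume "\<not> ?thesis"
    then have "cost y E < ennreal (c * w / ?k)" by simp
    \<comment> \<open>An intermediate value is used in place of the cost itself, since it is finite
      and strictly positive even if the cost is 0.\<close>
    then obtain t where t: "cost y E < t" "t < ennreal (c * w / ?k)" using dense by blast
    then obtain a where a: "t = ennreal a" "0 \<le> a" by (cases t) auto
    have "0 < t" using t(1) by (rule le_less_trans[OF zero_le])
    then have "0 < a" using a by simp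
    have ac: "a < c * w / ?k" using t a by (simp add: ennreal_less_iff)
    have "(\<integral>\<^sup>+z. ennreal (marginal y E z) \<partial>N) \<le> ennreal (a / w * ?k * v)"
      using \<open>0 < a\<close> wealth t a by (intro first_order_condition_scaled yE) (auto intro: less_imp_le)
    moreover have "(\<integral>\<^sup>+z. ennreal (marginal y E z) \<partial>N) = (\<integral>\<^sup>+z. ennreal c * ennreal (u z) \<partial>N)"
      using c by (intro nn_integral_cong_AE) (auto simp: ennreal_mult')
    moreover have "\<dots> = ennreal (c * v)"
      using c(2) by (simp add: nn_integral_cmult utility_eq ennreal_mult')
    ultimately have "c * v \<le> (a / w * ?k) * v"
      using c(2) v \<open>0 < a\<close> wealth elasticity by simp
    then have "c \<le> a / w * ?k" using v by (rule mult_right_le_imp_le)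
    then show False using ac wealth elasticity by (simp add: field_simps)
  qed
  have z: "(\<lambda>_. 0) \<in> A" "(\<lambda>_. 0) \<in> B" using cost_split[OF X D] by simp_all
  show "ennreal (\<alpha> * w / (\<alpha> + \<beta> / m)) \<le> cost X (\<lambda>_. 0)"
    using positive exponents by (intro key X z) (auto simp: marginal_def)
  have "AE z in N. marginal (\<lambda>_. 0) D z = \<beta> / m * u z"
    using positive by eventually_elim (simp add: marginal_def)
  then show "ennreal (\<beta> / m * w / (\<alpha> + \<beta> / m)) \<le> cost (\<lambda>_. 0) D"
    using exponents m by (intro key D z) auto
qed

text \<open>The two lower bounds already add up to \<open>w\<close>, so neither component can cost
  more without breaking the budget.\<close>

lemma expenditure_upper:
  assumes v: "0 < v"
  shows "cost X (\<lambda>_. 0) \<le> ennreal (\<alpha> * w / (\<alpha> + \<beta> / m))"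
    and "cost (\<lambda>_. 0) D \<le> ennreal (\<beta> / m * w / (\<alpha> + \<beta> / m))"
proof -
  define k where "k = \<alpha> + \<beta> / m"
  have k: "0 < k" using elasticity by (simp add: k_def)
  have "\<alpha> * w / k + \<beta> / m * w / k = (\<alpha> * w + \<beta> / m * w) / k" by (rule add_divide_distrib[symmetric])
  also have "\<alpha> * w + \<beta> / m * w = k * w" unfolding k_def by (rule distrib_right[symmetric])
  also have "k * w / k = w" using k by simp
  finally have w: "\<alpha> * w / k + \<beta> / m * w / k = w" .
  have nn: "0 \<le> \<alpha> * w / k" "0 \<le> \<beta> / m * w / k"
    using k exponents wealth m by simp_all
  have 1: "cost X (\<lambda>_. 0) + cost (\<lambda>_. 0) D \<le> ennreal (\<alpha> * w / k + \<beta> / m * w / k)"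
    unfolding w using budget cost_split(3)[OF X D] by simp
  then have 2: "cost (\<lambda>_. 0) D + cost X (\<lambda>_. 0) \<le> ennreal (\<beta> / m * w / k + \<alpha> * w / k)"
    by (simp only: add.commute)
  note lower = expenditure_lower[OF v, folded k_def]
  show "cost X (\<lambda>_. 0) \<le> ennreal (\<alpha> * w / (\<alpha> + \<beta> / m))"
    using ennreal_share_le[OF 2 lower(2) nn(2,1)] unfolding k_def .
  show "cost (\<lambda>_. 0) D \<le> ennreal (\<beta> / m * w / (\<alpha> + \<beta> / m))"
    using ennreal_share_le[OF 1 lower(1) nn] unfolding k_def .
qed

text \<open>The equilibrium bundle, rescaled by \<open>1 / (m * b)\<close> and \<open>1 / b\<close>, satisfies the planner's first-order
  conditions and exhausts his budget; the tangent plane of the utility at this bundle therefore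
  bounds the planner's welfare, with equality only at the bundle itself.\<close>

theorem planner_comparison:
  fixes n :: nat and x C :: "nat \<Rightarrow> 'b \<Rightarrow> real"
  defines "b \<equiv> (\<alpha> + \<beta>) / (m * \<alpha> + \<beta>)"
  assumes n: "m = real n" and x: "\<And>i. i < n \<Longrightarrow> x i \<in> A" and C: "\<And>i. i < n \<Longrightarrow> C i \<in> B"
    and feasible: "(\<Sum>i<n. cost (x i) (C i)) \<le> ennreal (m * w)"
    and optimal: "\<And>y E. y \<in> A \<Longrightarrow> E \<in> B \<Longrightarrow> cost y E \<le> ennreal w \<Longrightarrow>
      (\<Sum>i<n. utility y (\<lambda>z. m * E z)) \<le> (\<Sum>i<n. utility (x i) (\<lambda>z. \<Sum>j<n. C j z))"
  shows "AE z in N. 0 < (\<Sum>j<n. C j z) \<and> m * D z = b * (\<Sum>j<n. C j z)"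
proof (cases "v = 0")
  case True
  then show ?thesis by (rule AE_if_v_zero)
next
  case False
  then have v: "0 < v" using v_nonneg by simp
  have n0: "0 < n" using m n by simp
  have ma: "0 < m * \<alpha>" using exponents m by simp
  then have b: "0 < b" unfolding b_def using exponents by simp
  have mb: "0 < m * b" using b m by simp
  have mk: "m * (\<alpha> + \<beta> / m) = m * \<alpha> + \<beta>" using m by (simp add: distrib_left)
  \<comment> \<open>This identity determines \<open>b\<close>: it keeps the rescaled bundle within
    the budget \<open>w\<close> and reduces the integral of the tangent plane to at most m * K *
    v.\<close>
  then have bmk: "b * (m * (\<alpha> + \<beta> / m)) = \<alpha> + \<beta>" unfolding b_def using ma exponents by simp
  \<comment> \<open>By homogeneity, K * u is the utility of the rescaled bundle (X / (m * b), m * D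
    / b).\<close>
  define K where "K = (1 / (m * b)) powr \<alpha> * (1 / b) powr \<beta>"
  have K: "0 < K" unfolding K_def using mb b by (intro mult_pos_pos) (auto simp: powr_gt_zero)
  define Cs where "Cs = (\<lambda>z. \<Sum>j<n. C j z)"
  define S where "S = (\<lambda>z. \<Sum>i<n. cobb_douglas \<alpha> \<beta> (x i z) (Cs z))"
  \<comment> \<open>Sum over the agents of the tangent planes of utility at the rescaled bundle,
    evaluated at the planner's allocation; \<open>S\<close> is the sum of the utilities
    themselves.\<close>
  define T where "T = (\<lambda>z. \<Sum>i<n. K * u z * ((1 - \<alpha> - \<beta>) + \<alpha> * (m * b * x i z / X z) + \<beta> * (b * Cs z / (m * D z))))"
  \<comment> \<open>The average of the planner's plans costs at most \<open>w\<close>, so a single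
    agent's first-order condition can be tested with it.\<close>
  define y where "y = (\<lambda>z. 1 / m * (\<Sum>i<n. x i z))"
  define E where "E = (\<lambda>z. 1 / m * Cs z)"
  have sums: "(\<lambda>z. \<Sum>i<n. x i z) \<in> A" "Cs \<in> B" "cost (\<lambda>z. \<Sum>i<n. x i z) Cs = (\<Sum>i<n. cost (x i) (C i))"
    using cost_sum[of n x C, OF x C n0] unfolding Cs_def by blast+
  have yE: "y \<in> A" "E \<in> B"
    unfolding y_def E_def using m by (intro A_scale B_scale sums; simp)+
  note [measurable] = yE(1)[THEN A_measurable] yE(2)[THEN B_measurable] sums(2)[THEN B_measurable]
  have x_measurable: "x i \<in> borel_measurable N" if "i < n" for i using x[OF that] by (rule A_measurable)
  have S_measurable [measurable]: "S \<in> borel_measurable N"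
    unfolding S_def by (intro borel_measurable_sum measurable_cobb_douglas x_measurable) auto
  have T_measurable [measurable]: "T \<in> borel_measurable N"
  proof -
    have "(\<lambda>z. K * u z * ((1 - \<alpha> - \<beta>) + \<alpha> * (m * b * x i z / X z) + \<beta> * (b * Cs z / (m * D z))))
        \<in> borel_measurable N" if "i < n" for i
      using x_measurable[OF that, measurable] by measurable
    then show ?thesis unfolding T_def by (intro borel_measurable_sum) auto
  qed
  have "cost y E = ennreal (1 / m) * (\<Sum>i<n. cost (x i) (C i))"
    unfolding y_def E_def sums(3)[symmetric] using sums m by (intro cost_scale) auto
  also have "\<dots> \<le> ennreal (1 / m) * ennreal (m * w)" using feasible by (intro mult_left_mono) auto
  also have "\<dots> = ennreal (1 / m * (m * w))" using m by (intro ennreal_mult'[symmetric]) simp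
  also have "\<dots> = ennreal w" using m by simp
  finally have foc: "(\<integral>\<^sup>+z. ennreal (marginal y E z) \<partial>N) \<le> ennreal ((\<alpha> + \<beta> / m) * v)"
    by (rule first_order_condition[OF yE])
  have pw: "S z \<le> T z \<and> (S z = T z \<longrightarrow> b * Cs z = m * D z)
      \<and> T z = K * ((1 - \<alpha> - \<beta>) * m) * u z + K * (m * m * b) * marginal y E z"
    if z: "z \<in> space N" "0 < X z" "0 < D z" for z
  proof -
    define s where "s i = m * b * x i z / X z" for i
    define t where "t = b * Cs z / (m * D z)"
    have Cs0: "0 \<le> Cs z" using sums(2) z by (simp add: nonneg)
    have t0: "0 \<le> t" unfolding t_def using Cs0 b m z by simp
    have s0: "0 \<le> s i" if "i < n" for i
      unfolding s_def using mb m z A_nonneg[OF x[OF that] z(1)] by simp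
    have u0: "0 < u z" unfolding u_def using exponents z m by (intro cobb_douglas_pos) auto
    have Seq: "S z = (\<Sum>i<n. K * u z * (s i powr \<alpha> * t powr \<beta>))"
      unfolding S_def
    proof (rule sum.cong[OF refl])
      fix i assume "i \<in> {..<n}"
      then have si: "0 \<le> s i" using s0 by simp
      have 1: "x i z = s i * (1 / (m * b) * X z)" "Cs z = t * (1 / b * (m * D z))"
        using mb b z m by (simp_all add: s_def t_def)
      have nn: "0 \<le> 1 / (m * b)" "0 \<le> 1 / b" "0 \<le> X z" "0 \<le> m * D z" using mb b z m by simp_all
      from cobb_douglas_mult[OF this] have "cobb_douglas \<alpha> \<beta> (1 / (m * b) * X z) (1 / b * (m * D z)) = K * u z"
        unfolding K_def u_def .
      moreover have "0 \<le> 1 / (m * b) * X z" "0 \<le> 1 / b * (m * D z)" using nn by simp_all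
      ultimately have "cobb_douglas \<alpha> \<beta> (s i * (1 / (m * b) * X z)) (t * (1 / b * (m * D z))) =
          s i powr \<alpha> * t powr \<beta> * (K * u z)"
        using si t0 by (simp only: cobb_douglas_mult)
      then show "cobb_douglas \<alpha> \<beta> (x i z) (Cs z) = K * u z * (s i powr \<alpha> * t powr \<beta>)"
        unfolding 1[symmetric] by (simp add: mult.commute)
    qed
    have Teq: "T z = (\<Sum>i<n. K * u z * ((1 - \<alpha> - \<beta>) + \<alpha> * s i + \<beta> * t))"
      by (simp add: T_def s_def t_def)
    have "S z \<le> T z"
      unfolding Seq Teq using s0 t0 K u0 exponents
      by (intro sum_mono mult_left_mono powr_mult_powr_le_affine) auto
    moreover have "b * Cs z = m * D z" if "S z = T z"
    proof (rule ccontr)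
      assume "\<not> ?thesis"
      \<comment> \<open>t = 1 says exactly that \<open>Cs\<close> is the rescaled aggregate;
        otherwise AM-GM is strict for every agent at once, whatever the private shares
        \<open>s i\<close> are.\<close>
      then have "t \<noteq> 1" using m z by (simp add: t_def)
      then have "S z < T z"
        unfolding Seq Teq using s0 t0 K u0 exponents n0
        by (intro sum_strict_mono mult_strict_left_mono powr_mult_powr_less_affine) auto
      then show False using that by simp
    qed
    \<comment> \<open>The tangent planes are affine, so the sum over agents sees private consumption
      only through its average \<open>y\<close>. The coefficients then match those of
      \<open>marginal\<close>.\<close>
    moreover have "T z = K * ((1 - \<alpha> - \<beta>) * m) * u z + K * (m * m * b) * marginal y E z"
    proof -
      have "T z = K * u z * (m * (1 - \<alpha> - \<beta>) + \<alpha> * (\<Sum>i<n. s i) + m * (\<beta> * t))"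
        unfolding Teq by (simp add: sum_distrib_left[symmetric] sum.distrib n)
      also have "(\<Sum>i<n. s i) = m * m * b * (y z / X z)"
        using m by (simp add: s_def y_def sum_divide_distrib[symmetric] sum_distrib_left[symmetric])
      also have "m * (\<beta> * t) = m * m * b * (\<beta> / m * (E z / D z))"
        using m by (simp add: t_def E_def)
      finally show ?thesis by (simp add: marginal_def algebra_simps)
    qed
    ultimately show ?thesis by blast
  qed
  have "(\<integral>\<^sup>+z. ennreal (T z) \<partial>N) =
      (\<integral>\<^sup>+z. ennreal (K * ((1 - \<alpha> - \<beta>) * m) * u z + K * (m * m * b) * marginal y E z) \<partial>N)"
    using positive AE_space by (intro nn_integral_cong_AE, eventually_elim) (simp add: pw)
  also have "\<dots> = ennreal (K * ((1 - \<alpha> - \<beta>) * m)) * ennreal v +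
      ennreal (K * (m * m * b)) * (\<integral>\<^sup>+z. ennreal (marginal y E z) \<partial>N)"
    using K m b exponents u_nonneg marginal_nonneg[OF yE] unfolding utility_eq[symmetric]
    by (intro nn_integral_linear_combination) auto
  also have "\<dots> \<le> ennreal (K * ((1 - \<alpha> - \<beta>) * m)) * ennreal v +
      ennreal (K * (m * m * b)) * ennreal ((\<alpha> + \<beta> / m) * v)"
    using foc by (intro add_left_mono mult_left_mono) auto
  also have "\<dots> = ennreal (K * ((1 - \<alpha> - \<beta>) * m) * v + K * (m * m * b) * ((\<alpha> + \<beta> / m) * v))"
    using K m b exponents v elasticity by (simp add: ennreal_mult')
  also have "K * ((1 - \<alpha> - \<beta>) * m) * v + K * (m * m * b) * ((\<alpha> + \<beta> / m) * v) =
      K * m * v * (1 - \<alpha> - \<beta> + b * (m * (\<alpha> + \<beta> / m)))"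
    by (simp only: algebra_simps)
  also have "\<dots> = m * (K * v)" unfolding bmk by simp
  finally have T_le: "(\<integral>\<^sup>+z. ennreal (T z) \<partial>N) \<le> ennreal (m * (K * v))" .
  \<comment> \<open>The competitor gives every agent X / (m * b) and the contribution D / b. The
    known expenditure shares show that it is affordable, and its welfare is m * K * v.\<close>
  have S_ge: "ennreal (m * (K * v)) \<le> (\<integral>\<^sup>+z. ennreal (S z) \<partial>N)"
  proof -
    define X' where "X' = (\<lambda>z. 1 / (m * b) * X z)"
    define D' where "D' = (\<lambda>z. 1 / b * D z)"
    have z0: "(\<lambda>_. 0) \<in> A" "(\<lambda>_. 0) \<in> B" using cost_split[OF X D] by simp_all
    have XD': "X' \<in> A" "D' \<in> B" unfolding X'_def D'_def using mb b by (intro A_scale B_scale X D; simp)+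
    have "cost X' D' = cost X' (\<lambda>_. 0) + cost (\<lambda>_. 0) D'" by (rule cost_split(3)[OF XD'])
    also have "cost X' (\<lambda>_. 0) = ennreal (1 / (m * b)) * cost X (\<lambda>_. 0)"
      using cost_scale[OF X z0(2), of "1 / (m * b)"] mb by (simp add: X'_def)
    also have "cost (\<lambda>_. 0) D' = ennreal (1 / b) * cost (\<lambda>_. 0) D"
      using cost_scale[OF z0(1) D, of "1 / b"] b by (simp add: D'_def)
    also have "ennreal (1 / (m * b)) * cost X (\<lambda>_. 0) + ennreal (1 / b) * cost (\<lambda>_. 0) D \<le>
        ennreal (1 / (m * b)) * ennreal (\<alpha> * w / (\<alpha> + \<beta> / m)) +
        ennreal (1 / b) * ennreal (\<beta> / m * w / (\<alpha> + \<beta> / m))"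
      using expenditure_upper[OF v] by (intro add_mono mult_left_mono) auto
    also have "\<dots> = ennreal (1 / (m * b) * (\<alpha> * w / (\<alpha> + \<beta> / m)) + 1 / b * (\<beta> / m * w / (\<alpha> + \<beta> / m)))"
      using mb b m exponents elasticity wealth
      by (intro ennreal_linear_combination divide_nonneg_pos mult_nonneg_nonneg) auto
    also have "1 / (m * b) * (\<alpha> * w / (\<alpha> + \<beta> / m)) + 1 / b * (\<beta> / m * w / (\<alpha> + \<beta> / m)) =
        (\<alpha> + \<beta>) * w / (b * (m * (\<alpha> + \<beta> / m)))"
    proof -
      have "1 / (m * b) * (\<alpha> * w / k) + 1 / b * (\<beta> / m * w / k) = (\<alpha> + \<beta>) * w / (b * (m * k))"
        if "k \<noteq> 0" for k using m b that by (simp add: field_simps)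
      then show ?thesis using elasticity by simp
    qed
    also have "\<dots> = w" unfolding bmk using exponents by simp
    finally have "cost X' D' \<le> ennreal w" .
    from optimal[OF XD' this] have le: "(\<Sum>i<n. utility X' (\<lambda>z. m * D' z)) \<le> (\<Sum>i<n. utility (x i) Cs)"
      unfolding Cs_def .
    have "utility X' (\<lambda>z. m * D' z) = (\<integral>\<^sup>+z. ennreal K * ennreal (u z) \<partial>N)"
      unfolding utility_def
    proof (rule nn_integral_cong)
      fix z assume "z \<in> space N"
      then have "0 \<le> X z" "0 \<le> m * D z" using X D m by (simp_all add: nonneg)
      then have "cobb_douglas \<alpha> \<beta> (1 / (m * b) * X z) (1 / b * (m * D z)) = K * u z"
        using mb b unfolding K_def u_def by (intro cobb_douglas_mult) auto
      moreover have "m * D' z = 1 / b * (m * D z)" by (simp add: D'_def)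
      ultimately show "ennreal (cobb_douglas \<alpha> \<beta> (X' z) (m * D' z)) = ennreal K * ennreal (u z)"
        unfolding X'_def using K by (simp only: ennreal_mult' less_imp_le)
    qed
    also have "\<dots> = ennreal (K * v)" using K by (simp add: nn_integral_cmult utility_eq ennreal_mult')
    finally have "(\<Sum>i<n. utility X' (\<lambda>z. m * D' z)) = ennreal (m * (K * v))"
      using n by (simp add: ennreal_mult' ennreal_of_nat_eq_real_of_nat)
    moreover have "(\<Sum>i<n. utility (x i) Cs) = (\<integral>\<^sup>+z. ennreal (S z) \<partial>N)"
      unfolding utility_def S_def using exponents
      by (subst nn_integral_sum[symmetric])
        (auto simp: cobb_douglas_nonneg sum_ennreal intro!: measurable_cobb_douglas x_measurable)
    ultimately show ?thesis using le by simp
  qed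
  have ST: "AE z in N. S z \<le> T z" using positive AE_space by eventually_elim (use pw in blast)
  have Snn: "0 \<le> S z" for z unfolding S_def using exponents by (intro sum_nonneg cobb_douglas_nonneg)
  \<comment> \<open>The nonnegative gap T - S is added rather than subtracted. As the integral of
    \<open>S\<close> is finite and not below that of \<open>T\<close>, the gap integrates to
    0.\<close>
  have "(\<integral>\<^sup>+z. ennreal (S z) \<partial>N) + (\<integral>\<^sup>+z. ennreal (T z - S z) \<partial>N) = (\<integral>\<^sup>+z. ennreal (T z) \<partial>N)"
  proof -
    have "(\<integral>\<^sup>+z. ennreal (T z) \<partial>N) = (\<integral>\<^sup>+z. ennreal (S z) + ennreal (T z - S z) \<partial>N)"
      using ST by (intro nn_integral_cong_AE, eventually_elim) (simp add: Snn flip: ennreal_plus)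
    then show ?thesis by (simp add: nn_integral_add)
  qed
  also have "\<dots> \<le> (\<integral>\<^sup>+z. ennreal (S z) \<partial>N) + 0" using T_le S_ge by simp
  finally have "(\<integral>\<^sup>+z. ennreal (S z) \<partial>N) = \<infinity> \<or> (\<integral>\<^sup>+z. ennreal (T z - S z) \<partial>N) \<le> 0"
    by (simp only: ennreal_add_left_cancel_le)
  moreover have "(\<integral>\<^sup>+z. ennreal (S z) \<partial>N) \<noteq> \<infinity>"
  proof -
    have "(\<integral>\<^sup>+z. ennreal (S z) \<partial>N) \<le> (\<integral>\<^sup>+z. ennreal (T z) \<partial>N)"
      using ST by (intro nn_integral_mono_AE, eventually_elim) (rule ennreal_leI)
    also have "\<dots> \<le> ennreal (m * (K * v))" by (rule T_le)
    finally show ?thesis by (auto simp: top_unique)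
  qed
  ultimately have "(\<integral>\<^sup>+z. ennreal (T z - S z) \<partial>N) = 0" by simp
  then have "AE z in N. ennreal (T z - S z) = 0" by (subst (asm) nn_integral_0_iff_AE) auto
  with positive AE_space have "AE z in N. 0 < Cs z \<and> m * D z = b * Cs z"
  proof eventually_elim
    case (elim z)
    then have "S z = T z" using pw[of z] by (auto simp: ennreal_eq_0_iff)
    then have *: "b * Cs z = m * D z" using pw[of z] elim by simp
    moreover have "0 < m * D z" using m elim by simp
    ultimately have "0 < Cs z" using b zero_less_mult_pos[of b "Cs z"] by simp
    then show ?case using * by simp
  qed
  then show ?thesis unfolding Cs_def .
qed

end

subsection \<open>Stieltjes costs and optional processes\<close>

lemma stieltjes_measure:
  fixes f :: "real \<Rightarrow> real"
  assumes mono: "mono_on {0..} f" and nonneg: "\<And>t. 0 \<le> t \<Longrightarrow> 0 \<le> f t"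
    and rc: "\<And>t. 0 \<le> t \<Longrightarrow> continuous (at_right t) f" and s: "0 \<le> s"
  shows "emeasure (stieltjes f) {0..s} = ennreal (f s)" and "sigma_finite_measure (stieltjes f)"
proof -
  define G where "G t = (if t < 0 then 0 else f t)" for t
  have st: "stieltjes f = interval_measure G" by (simp add: stieltjes_def G_def[abs_def])
  have G_mono: "G x \<le> G y" if "x \<le> y" for x y
    using that mono_onD[OF mono, of x y] nonneg[of y] by (auto simp: G_def)
  have G_rc: "continuous (at_right a) G" for a
  proof (cases "a < 0")
    case True
    have "eventually (\<lambda>x. G x = 0) (at_right a)"
      using True by (intro eventually_at_rightI[of a 0]) (auto simp: G_def)
    then have "(G \<longlongrightarrow> 0) (at_right a)" by (rule tendsto_eventually)
    then show ?thesis using True by (simp add: continuous_within G_def)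
  next
    case False
    have "eventually (\<lambda>x. f x = G x) (at_right a)"
      using False by (intro eventually_at_rightI[of a "a + 1"]) (auto simp: G_def)
    moreover have "(f \<longlongrightarrow> f a) (at_right a)"
      using rc[of a] False by (simp add: continuous_within)
    ultimately have "(G \<longlongrightarrow> f a) (at_right a)" by (rule Lim_transform_eventually[rotated])
    then show ?thesis using False by (simp add: continuous_within G_def)
  qed
  show "sigma_finite_measure (stieltjes f)"
    unfolding st using G_mono G_rc by (rule sigma_finite_interval_measure)
  have Ioc: "emeasure (interval_measure G) {a<..b} = ennreal (G b - G a)" if "a \<le> b" for a b
    using that G_mono G_rc by (rule emeasure_interval_measure_Ioc)
  \<comment> \<open>Interval measures are known on half-open intervals only. The closed interval
    from 0 to s, including the atom at 0, is obtained from the half-open one from -1 to s by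
    discarding the open interval from -1 to 0, which is null because the extended path vanishes
    there.\<close>
  have "{-1<..<0::real} = (\<Union>k. {-1<..- (1 / real (Suc k))})"
  proof (intro set_eqI iffI)
    fix x :: real assume x: "x \<in> {-1<..<0}"
    then obtain k where "1 / real (Suc k) < - x" using reals_Archimedean[of "- x"] by (auto simp: inverse_eq_divide)
    then show "x \<in> (\<Union>k. {-1<..- (1 / real (Suc k))})" using x by (auto intro!: exI[of _ k])
  next
    fix x :: real assume "x \<in> (\<Union>k. {-1<..- (1 / real (Suc k))})"
    then obtain k where "-1 < x" "x \<le> - (1 / real (Suc k))" by auto
    moreover have "0 < 1 / real (Suc k)" by simp
    ultimately show "x \<in> {-1<..<0}" unfolding greaterThanLessThan_iff by linarith
  qed
  moreover have "(\<Union>k. {-1<..- (1 / real (Suc k))}) \<in> null_sets (interval_measure G)"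
  proof (rule null_sets_UN)
    fix k
    have "(1 :: real) / real (Suc k) \<le> 1" "0 < (1 :: real) / real (Suc k)" by simp_all
    then have "emeasure (interval_measure G) {-1<..- (1 / real (Suc k))} = 0"
      by (subst Ioc) (auto simp: G_def)
    then show "{-1<..- (1 / real (Suc k))} \<in> null_sets (interval_measure G)" by (intro null_setsI) auto
  qed
  ultimately have "{-1<..<0::real} \<in> null_sets (interval_measure G)" by simp
  then have "emeasure (interval_measure G) {0..s} = emeasure (interval_measure G) ({0..s} \<union> {-1<..<0})"
    by (intro emeasure_Un_null_set[symmetric]) auto
  also have "{0..s} \<union> {-1<..<0} = {-1<..s}" using s by auto
  also have "emeasure (interval_measure G) {-1<..s} = ennreal (f s)"
    using s by (subst Ioc) (auto simp: G_def)
  finally show "emeasure (stieltjes f) {0..s} = ennreal (f s)" unfolding st .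
qed

lemma nn_integral_exp_stieltjes:
  fixes f :: "real \<Rightarrow> real"
  assumes mono: "mono_on {0..} f" and nonneg: "\<And>t. 0 \<le> t \<Longrightarrow> 0 \<le> f t"
    and rc: "\<And>t. 0 \<le> t \<Longrightarrow> continuous (at_right t) f" and r: "0 < r"
  shows "(\<integral>\<^sup>+t\<in>{0..}. ennreal (exp (- r * t)) \<partial>stieltjes f) =
    ennreal r * (\<integral>\<^sup>+t\<in>{0..}. ennreal (exp (- r * t) * f t) \<partial>lborel)"
proof -
  note st = stieltjes_measure[OF mono nonneg rc]
  have sets: "sets (stieltjes f) = sets borel" by (simp add: stieltjes_def)
  interpret S: sigma_finite_measure "stieltjes f" using st(2)[of 0] by simp
  interpret pair_sigma_finite "stieltjes f" lborel by standard
  \<comment> \<open>A unit contributed at time t is charged the rental rate r * exp (- r * s) at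
    every later s. Integrating over s gives its discounted price, integrating over t gives the
    accumulated stock at s.\<close>
  define h :: "real \<times> real \<Rightarrow> ennreal" where
    "h = (\<lambda>(t, s). indicator {0..} t * (ennreal (r * exp (- r * s)) * indicator {t..} s))"
  have "h = (\<lambda>p. indicator {0..} (fst p) * (ennreal (r * exp (- r * snd p)) * indicator {p. fst p \<le> snd p} p))"
    by (auto simp: h_def fun_eq_iff split: split_indicator)
  moreover have "\<dots> \<in> borel_measurable (borel \<Otimes>\<^sub>M borel)" by measurable
  ultimately have "h \<in> borel_measurable (borel \<Otimes>\<^sub>M borel)" by (simp only:)
  moreover have sp: "sets (stieltjes f \<Otimes>\<^sub>M lborel) = sets (borel \<Otimes>\<^sub>M borel)"
    by (intro sets_pair_measure_cong sets) simp
  ultimately have h: "h \<in> borel_measurable (stieltjes f \<Otimes>\<^sub>M lborel)"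
    by (subst measurable_cong_sets[OF sp refl])
  have tail: "(\<integral>\<^sup>+s. ennreal (r * exp (- r * s)) * indicator {t..} s \<partial>lborel) = ennreal (exp (- r * t))" for t
  proof -
    have "((\<lambda>s. - exp (- r * s)) \<longlongrightarrow> - 0) at_top"
    proof (intro tendsto_minus filterlim_compose[OF exp_at_bot])
      show "filterlim (\<lambda>s. - r * s) at_bot at_top"
        using r by (intro filterlim_tendsto_neg_mult_at_bot[OF tendsto_const _ filterlim_ident]) simp
    qed
    then have "(\<integral>\<^sup>+s. ennreal (r * exp (- r * s)) * indicator {t..} s \<partial>lborel) = ennreal (0 - - exp (- r * t))"
      using r by (intro nn_integral_FTC_atLeast) (auto intro!: derivative_eq_intros)
    then show ?thesis by simp
  qed
  have "(\<integral>\<^sup>+t\<in>{0..}. ennreal (exp (- r * t)) \<partial>stieltjes f) =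
      (\<integral>\<^sup>+t. (\<integral>\<^sup>+s. h (t, s) \<partial>lborel) \<partial>stieltjes f)"
    unfolding tail[symmetric] h_def by (simp add: nn_integral_cmult mult.commute)
  also have "\<dots> = (\<integral>\<^sup>+s. (\<integral>\<^sup>+t. h (t, s) \<partial>stieltjes f) \<partial>lborel)"
    by (rule Fubini[OF h, symmetric])
  also have "\<dots> = (\<integral>\<^sup>+s. ennreal r * (ennreal (exp (- r * s) * f s) * indicator {0..} s) \<partial>lborel)"
  proof (rule nn_integral_cong)
    fix s :: real
    have "h (t, s) = ennreal (r * exp (- r * s)) * indicator {0..s} t" for t
      by (auto simp: h_def split: split_indicator)
    then have "(\<integral>\<^sup>+t. h (t, s) \<partial>stieltjes f) = ennreal (r * exp (- r * s)) * emeasure (stieltjes f) {0..s}"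
      by (simp add: nn_integral_cmult_indicator sets)
    also have "\<dots> = ennreal r * (ennreal (exp (- r * s) * f s) * indicator {0..} s)"
    proof (cases "0 \<le> s")
      case True
      then show ?thesis using r st(1)[of s] by (simp add: ennreal_mult' mult.assoc)
    next
      case False
      then have "{0..s} = {}" by simp
      then show ?thesis using False by simp
    qed
    finally show "(\<integral>\<^sup>+t. h (t, s) \<partial>stieltjes f) =
      ennreal r * (ennreal (exp (- r * s) * f s) * indicator {0..} s)" .
  qed
  also have "\<dots> = ennreal r * (\<integral>\<^sup>+t\<in>{0..}. ennreal (exp (- r * t) * f t) \<partial>lborel)"
  proof (rule nn_integral_cmult)
    have "(\<lambda>s. ennreal (f s) * indicator {0..} s) \<in> borel_measurable borel"
    proof -
      \<comment> \<open>\<open>f\<close> is arbitrary at negative times; freezing it there at its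
        value at 0 yields a function that is monotone on the whole line, hence Borel.\<close>
      define g where "g s = f (max 0 s)" for s
      have "mono g" unfolding g_def by (auto intro!: monoI mono_onD[OF mono])
      then have [measurable]: "g \<in> borel_measurable borel" by (rule borel_measurable_mono)
      have "(\<lambda>s. ennreal (f s) * indicator {0..} s) = (\<lambda>s. ennreal (g s) * indicator {0..} s)"
        by (auto simp: g_def fun_eq_iff split: split_indicator)
      then show ?thesis by simp
    qed
    then have "(\<lambda>s. ennreal (exp (- r * s)) * (ennreal (f s) * indicator {0..} s)) \<in> borel_measurable borel"
      by measurable
    then show "(\<lambda>s. ennreal (exp (- r * s) * f s) * indicator {0..} s) \<in> borel_measurable lborel"
      by (simp add: ennreal_mult' mult.assoc)
  qed
  finally show ?thesis .
qed

section \<open>Joint measurability of optional processes\<close>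

definition uncurried :: "'a process \<Rightarrow> 'a \<times> real \<Rightarrow> real" where
  "uncurried X = (\<lambda>(\<omega>, t). X t \<omega>)"

lemma space_time_product: "space (M \<Otimes>\<^sub>M restrict_space lborel {0::real..}) = space M \<times> {0..}"
  by (simp add: space_pair_measure space_restrict_space)

lemma snd_measurable_time [measurable]:
  "snd \<in> borel_measurable (M \<Otimes>\<^sub>M restrict_space lborel {0::real..})"
proof -
  have "(\<lambda>t. t) \<in> borel_measurable (restrict_space lborel {0::real..})"
    by (intro measurable_restrict_space1) simp
  then have "(\<lambda>z. snd z) \<in> borel_measurable (M \<Otimes>\<^sub>M restrict_space lborel {0::real..})"
    by (rule measurable_compose[OF measurable_snd])
  then show ?thesis by simp
qed

text \<open>Sampling the process at the next grid point to the right of t involves only countably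
  many random variables, and right continuity lets the mesh tend to 0. The sampled value lies in the
  future of t, which is harmless since measurability is claimed with respect to \<open>M\<close> and
  not to the filtration.\<close>

lemma adapted_right_continuous_measurable:
  assumes F: "\<And>t. 0 \<le> t \<Longrightarrow> subalgebra M (F t)" and X: "adapted F X"
    and rc: "\<And>\<omega> t. \<omega> \<in> space M \<Longrightarrow> 0 \<le> t \<Longrightarrow> continuous (at_right t) (\<lambda>s. X s \<omega>)"
  shows "uncurried X \<in> borel_measurable (M \<Otimes>\<^sub>M restrict_space lborel {0..})"
proof (rule borel_measurable_LIMSEQ_real)
  let ?P = "M \<Otimes>\<^sub>M restrict_space lborel {0::real..}"
  define g :: "nat \<Rightarrow> real \<Rightarrow> nat" where "g k t = nat \<lfloor>t * real (Suc k)\<rfloor>" for k t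
  \<comment> \<open>Adding 1 puts the grid point strictly to the right of t, at distance at most the
    mesh 1 / (k + 1).\<close>
  define \<tau> where "\<tau> k i = (real i + 1) / real (Suc k)" for k i :: nat
  show "(\<lambda>z. X (\<tau> k (g k (snd z))) (fst z)) \<in> borel_measurable ?P" for k
  proof (rule measurable_compose_countable)
    fix i
    have "0 \<le> \<tau> k i" by (simp add: \<tau>_def)
    then have "X (\<tau> k i) \<in> borel_measurable M"
      using X F unfolding adapted_def by (blast intro: measurable_from_subalg)
    then show "(\<lambda>z. X (\<tau> k i) (fst z)) \<in> borel_measurable ?P" by measurable
  next
    show "(\<lambda>z. g k (snd z)) \<in> measurable ?P (count_space UNIV)" unfolding g_def by measurable
  qed
  fix z assume "z \<in> space ?P"
  then obtain \<omega> t where z: "z = (\<omega>, t)" "\<omega> \<in> space M" "0 \<le> t" by (auto simp: space_time_product)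
  have lower: "t < \<tau> k (g k t)" and upper: "\<tau> k (g k t) \<le> t + 1 / real (Suc k)" for k
  proof -
    have "0 \<le> t * real (Suc k)" using z by simp
    then have "real (g k t) \<le> t * real (Suc k)" "t * real (Suc k) < real (g k t) + 1"
      unfolding g_def by linarith+
    then show "t < \<tau> k (g k t)" "\<tau> k (g k t) \<le> t + 1 / real (Suc k)"
      by (simp_all add: \<tau>_def pos_less_divide_eq pos_divide_le_eq distrib_right del: of_nat_Suc)
  qed
  have "(\<lambda>k. t + 1 / real (Suc k)) \<longlonglongrightarrow> t + 0"
    by (intro tendsto_add tendsto_const) (rule LIMSEQ_Suc[OF lim_1_over_n])
  then have lim: "(\<lambda>k. t + 1 / real (Suc k)) \<longlonglongrightarrow> t" by simp
  have "(\<lambda>k. \<tau> k (g k t)) \<longlonglongrightarrow> t"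
    by (rule tendsto_sandwich[OF _ _ tendsto_const lim]) (simp_all only: lower upper less_imp_le eventually_True)
  then have "filterlim (\<lambda>k. \<tau> k (g k t)) (at_right t) sequentially"
    using lower by (simp add: filterlim_at less_imp_neq[symmetric] less_imp_neq)
  moreover have "((\<lambda>s. X s \<omega>) \<longlongrightarrow> X t \<omega>) (at_right t)"
    using rc[OF z(2,3)] by (simp add: continuous_within)
  ultimately show "(\<lambda>k. X (\<tau> k (g k (snd z))) (fst z)) \<longlonglongrightarrow> uncurried X z"
    unfolding z uncurried_def by (auto intro: filterlim_compose)
qed

lemma space_optional_algebra: "space (optional_algebra M F) = {0..} \<times> space M"
  unfolding optional_algebra_def by (rule space_measure_of) auto

text \<open>It suffices to look at the generators of the optional sigma-algebra, and these come from
  adapted right-continuous processes.\<close>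

lemma optional_process_measurable:
  assumes F: "\<And>t. 0 \<le> t \<Longrightarrow> subalgebra M (F t)" and X: "optional_process M F X"
  shows "uncurried X \<in> borel_measurable (M \<Otimes>\<^sub>M restrict_space lborel {0..})"
proof -
  let ?P = "M \<Otimes>\<^sub>M restrict_space lborel {0::real..}"
  \<comment> \<open>Optional sets consist of pairs with time in front, whereas the product with
    \<open>M\<close> has time second; hence the swap.\<close>
  have "(\<lambda>(\<omega>, t). (t, \<omega>)) \<in> measurable ?P (optional_algebra M F)"
    unfolding optional_algebra_def
  proof (rule measurable_measure_of, safe)
    fix Y :: "'a process" and B :: "real set"
    assume Y: "adapted F Y" "\<forall>\<omega>\<in>space M. cadlag (\<lambda>t. Y t \<omega>)" and B: "B \<in> sets borel"
    have "uncurried Y \<in> borel_measurable ?P"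
      using Y by (intro adapted_right_continuous_measurable[of M F]) (auto simp: cadlag_def F)
    from measurable_sets[OF this B]
    have "uncurried Y -` B \<inter> space ?P \<in> sets ?P" .
    also have "uncurried Y -` B \<inter> space ?P = (\<lambda>(\<omega>, t). (t, \<omega>)) -`
        {(t, \<omega>). t \<ge> 0 \<and> \<omega> \<in> space M \<and> Y t \<omega> \<in> B} \<inter> space ?P"
      by (auto simp: uncurried_def space_time_product)
    finally show "(\<lambda>(\<omega>, t). (t, \<omega>)) -` {(t, \<omega>). t \<ge> 0 \<and> \<omega> \<in> space M \<and> Y t \<omega> \<in> B} \<inter> space ?P \<in> sets ?P" .
  qed (auto simp: space_time_product)
  from measurable_compose[OF this X[unfolded optional_process_def]]
  show ?thesis by (simp add: uncurried_def split_def)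
qed

lemma optional_processI:
  assumes "adapted F X" "\<And>\<omega>. \<omega> \<in> space M \<Longrightarrow> cadlag (\<lambda>t. X t \<omega>)"
  shows "optional_process M F X"
  unfolding optional_process_def
proof (rule measurableI)
  fix B :: "real set" assume B: "B \<in> sets borel"
  let ?G = "{{(t, \<omega>). t \<ge> 0 \<and> \<omega> \<in> space M \<and> X t \<omega> \<in> B} | X B.
          adapted F X \<and> (\<forall>\<omega>\<in>space M. cadlag (\<lambda>t. X t \<omega>)) \<and> B \<in> sets borel}"
  have "{(t, \<omega>). t \<ge> 0 \<and> \<omega> \<in> space M \<and> X t \<omega> \<in> B} \<in> ?G" using assms B by blast
  then have "{(t, \<omega>). t \<ge> 0 \<and> \<omega> \<in> space M \<and> X t \<omega> \<in> B} \<in> sets (optional_algebra M F)"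
    unfolding optional_algebra_def by (subst sets_measure_of) (auto intro: sigma_sets.Basic)
  moreover have "(\<lambda>(t, \<omega>). X t \<omega>) -` B \<inter> space (optional_algebra M F) =
      {(t, \<omega>). t \<ge> 0 \<and> \<omega> \<in> space M \<and> X t \<omega> \<in> B}"
    by (auto simp: space_optional_algebra)
  ultimately show "(\<lambda>(t, \<omega>). X t \<omega>) -` B \<inter> space (optional_algebra M F) \<in> sets (optional_algebra M F)"
    by (simp only:)
qed simp

lemma optional_process_add:
  "optional_process M F X \<Longrightarrow> optional_process M F Y \<Longrightarrow> optional_process M F (\<lambda>t \<omega>. X t \<omega> + Y t \<omega>)"
  unfolding optional_process_def split_def by (rule borel_measurable_add)

lemma optional_process_scale:
  "optional_process M F X \<Longrightarrow> optional_process M F (\<lambda>t \<omega>. a * X t \<omega>)"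
  unfolding optional_process_def split_def by measurable

lemma cadlag_continuous:
  assumes "continuous_on {0..} f"
  shows "cadlag f"
proof -
  have c: "(f \<longlongrightarrow> f t) (at t within {0..})" if "0 \<le> t" for t
    using assms that by (auto simp: continuous_on)
  have "(f \<longlongrightarrow> f t) (at_right t)" if "0 \<le> t" for t
    by (rule tendsto_within_subset[OF c[OF that]]) (use that in auto)
  moreover have "(f \<longlongrightarrow> f t) (at_left t)" if "0 < t" for t
  proof -
    have "(f \<longlongrightarrow> f t) (at t)"
      using c[of t] at_within_interior[of t "{0..}"] that by simp
    then show ?thesis by (rule tendsto_within_subset) simp
  qed
  ultimately show ?thesis by (auto simp: cadlag_def continuous_within)
qed

text \<open>Completing the square turns the exponentially tilted density into a multiple of the
  normal density with mean - k * s^2.\<close>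

lemma nn_integral_normal_exp:
  assumes s: "0 < s"
  shows "(\<integral>\<^sup>+x. ennreal (normal_density 0 s x) * ennreal (exp (- k * x)) \<partial>lborel) = ennreal (exp (k\<^sup>2 * s\<^sup>2 / 2))"
proof -
  have "normal_density 0 s x * exp (- k * x) = exp (k\<^sup>2 * s\<^sup>2 / 2) * normal_density (- k * s\<^sup>2) s x" for x
  proof -
    have "- (x - 0)\<^sup>2 / (2 * s\<^sup>2) + - k * x = k\<^sup>2 * s\<^sup>2 / 2 + - (x - - k * s\<^sup>2)\<^sup>2 / (2 * s\<^sup>2)"
      using s by (simp add: field_simps power2_eq_square)
    then have "exp (- (x - 0)\<^sup>2 / (2 * s\<^sup>2)) * exp (- k * x) = exp (k\<^sup>2 * s\<^sup>2 / 2) * exp (- (x - - k * s\<^sup>2)\<^sup>2 / (2 * s\<^sup>2))"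
      by (simp only: exp_add[symmetric])
    then show ?thesis unfolding normal_density_def by simp
  qed
  then have "(\<integral>\<^sup>+x. ennreal (normal_density 0 s x) * ennreal (exp (- k * x)) \<partial>lborel) =
      (\<integral>\<^sup>+x. ennreal (exp (k\<^sup>2 * s\<^sup>2 / 2)) * ennreal (normal_density (- k * s\<^sup>2) s x) \<partial>lborel)"
    by (simp add: ennreal_mult'[symmetric])
  also have "\<dots> = ennreal (exp (k\<^sup>2 * s\<^sup>2 / 2)) * emeasure (density lborel (normal_density (- k * s\<^sup>2) s)) UNIV"
    by (simp add: nn_integral_cmult emeasure_density)
  also have "emeasure (density lborel (normal_density (- k * s\<^sup>2) s)) UNIV = 1"
    using prob_space.emeasure_space_1[OF prob_space_normal_density[OF s]] by simp
  finally show ?thesis by simp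
qed

subsection \<open>The Brownian economy\<close>

lemma uncurried_apply: "uncurried X (\<omega>, t) = X t \<omega>"
  by (simp add: uncurried_def)

lemma payoff_cong:
  assumes "\<And>t \<omega>. 0 \<le> t \<Longrightarrow> \<omega> \<in> space M \<Longrightarrow> c t \<omega> = c' t \<omega>"
  shows "payoff M r u x c = payoff M r u x c'"
  unfolding payoff_def using assms
  by (intro nn_integral_cong) (auto split: split_indicator)

text \<open>Optionality and sign are the requirements shared by consumption and contributions in
  both economies; irreversible contributions add monotonicity and right continuity.\<close>

definition private_strategy :: "'a measure \<Rightarrow> (real \<Rightarrow> 'a measure) \<Rightarrow> 'a process \<Rightarrow> bool" where
  "private_strategy M F x \<longleftrightarrow> optional_process M F x \<and> (\<forall>\<omega>\<in>space M. \<forall>t\<ge>0. 0 \<le> x t \<omega>)"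

locale brownian_economy =
  fixes M :: "'a measure" and F :: "real \<Rightarrow> 'a measure" and W :: "'a process"
    and r \<sigma> \<alpha> \<beta> :: real
  assumes basis: "usual_conditions M F" and bm: "brownian_motion M F W"
    and r: "0 < r" and \<sigma>: "0 < \<sigma>" and exponents: "0 < \<alpha>" "0 < \<beta>" "\<alpha> + \<beta> < 1"
    and r_large: "\<sigma> * \<alpha> / (1 - \<alpha> - \<beta>) < sqrt (2 * r)"
begin

sublocale prob_space M
  using basis by (simp add: usual_conditions_def)

abbreviation T :: "real measure" where "T \<equiv> restrict_space lborel {0..}"

abbreviation P :: "('a \<times> real) measure" where "P \<equiv> M \<Otimes>\<^sub>M T"

text \<open>Discounting is absorbed into the measure. The public good then has the constant price r
  per unit of stock and time, and the private price reduces to \<open>price\<close>.\<close>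

definition N :: "('a \<times> real) measure" where
  "N = density P (\<lambda>z. ennreal (exp (- r * snd z)))"

definition price :: "'a \<times> real \<Rightarrow> real" where
  "price z = exp (\<sigma> * uncurried W z)"

abbreviation \<psi>\<^sub>x :: "'a process" where "\<psi>\<^sub>x \<equiv> (\<lambda>t \<omega>. exp (- r * t + \<sigma> * W t \<omega>))"
abbreviation \<psi>\<^sub>c :: "'a process" where "\<psi>\<^sub>c \<equiv> (\<lambda>t \<omega>. exp (- r * t))"

section \<open>Costs and payoffs as integrals over space-time\<close>

lemma sub: "0 \<le> t \<Longrightarrow> subalgebra M (F t)"
  using basis by (simp add: usual_conditions_def)

lemma sigma_finite_T: "sigma_finite_measure T"
  by (rule sigma_finite_measure_restrict_space) (auto simp: lborel.sigma_finite_measure_axioms)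

sublocale T: sigma_finite_measure T by (rule sigma_finite_T)

lemma sets_N [measurable_cong, simp]: "sets N = sets P" by (simp add: N_def)
lemma space_N: "space N = space M \<times> {0..}" by (simp add: N_def space_time_product)

lemma W_measurable [measurable]: "uncurried W \<in> borel_measurable P"
proof (rule adapted_right_continuous_measurable[of M F])
  fix \<omega> and t :: real assume "\<omega> \<in> space M" "0 \<le> t"
  then have "cadlag (\<lambda>t. W t \<omega>)" using bm by (intro cadlag_continuous) (auto simp: brownian_motion_def)
  then show "continuous (at_right t) (\<lambda>s. W s \<omega>)" using \<open>0 \<le> t\<close> by (simp add: cadlag_def)
qed (use bm sub in \<open>auto simp: brownian_motion_def\<close>)

lemma price_measurable [measurable]: "price \<in> borel_measurable P"
  unfolding price_def[abs_def] by measurable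

lemma integral_T: "(\<integral>\<^sup>+t\<in>{0..}. g t \<partial>lborel) = (\<integral>\<^sup>+t. g t \<partial>T)"
  by (simp add: nn_integral_restrict_space)

lemma nn_integral_N:
  assumes [measurable]: "g \<in> borel_measurable P"
  shows "(\<integral>\<^sup>+z. g z \<partial>N) = (\<integral>\<^sup>+\<omega>. (\<integral>\<^sup>+t. ennreal (exp (- r * t)) * g (\<omega>, t) \<partial>T) \<partial>M)"
proof -
  have "(\<integral>\<^sup>+z. g z \<partial>N) = (\<integral>\<^sup>+z. ennreal (exp (- r * snd z)) * g z \<partial>P)"
    unfolding N_def by (rule nn_integral_density) measurable
  also have "\<dots> = (\<integral>\<^sup>+\<omega>. (\<integral>\<^sup>+t. ennreal (exp (- r * snd (\<omega>, t))) * g (\<omega>, t) \<partial>T) \<partial>M)"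
    by (rule T.nn_integral_fst[symmetric]) measurable
  finally show ?thesis by simp
qed

lemma private_measurable:
  assumes "private_strategy M F x"
  shows "uncurried x \<in> borel_measurable P"
proof (rule optional_process_measurable)
  show "optional_process M F x" using assms by (simp add: private_strategy_def)
qed (rule sub)

lemma payoff_eq:
  assumes [measurable]: "uncurried x \<in> borel_measurable P" "uncurried c \<in> borel_measurable P"
  shows "payoff M r (cobb_douglas \<alpha> \<beta>) x c =
    (\<integral>\<^sup>+z. ennreal (cobb_douglas \<alpha> \<beta> (uncurried x z) (uncurried c z)) \<partial>N)"
proof -
  have "(\<integral>\<^sup>+z. ennreal (cobb_douglas \<alpha> \<beta> (uncurried x z) (uncurried c z)) \<partial>N) =
      (\<integral>\<^sup>+\<omega>. (\<integral>\<^sup>+t. ennreal (exp (- r * t)) *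
        ennreal (cobb_douglas \<alpha> \<beta> (uncurried x (\<omega>, t)) (uncurried c (\<omega>, t))) \<partial>T) \<partial>M)"
    by (rule nn_integral_N) measurable
  then show ?thesis by (simp add: payoff_def integral_T uncurried_def ennreal_mult')
qed

lemma reversible_cost_eq:
  assumes x: "private_strategy M F x" and c: "private_strategy M F c"
  shows "reversible_cost M r \<psi>\<^sub>x \<psi>\<^sub>c x c =
    (\<integral>\<^sup>+z. ennreal (price z * uncurried x z + r * uncurried c z) \<partial>N)"
proof -
  note [measurable] = private_measurable[OF x] private_measurable[OF c]
  have "reversible_cost M r \<psi>\<^sub>x \<psi>\<^sub>c x c =
      (\<integral>\<^sup>+\<omega>. (\<integral>\<^sup>+t. ennreal (exp (- r * t)) * ennreal (price (\<omega>, t) * uncurried x (\<omega>, t) + r * uncurried c (\<omega>, t)) \<partial>T) \<partial>M)"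
    unfolding reversible_cost_def integral_T
  proof (rule nn_integral_cong)
    fix \<omega> assume \<omega>: "\<omega> \<in> space M"
    have [measurable]: "(\<lambda>t. g (\<omega>, t)) \<in> borel_measurable T" if "g \<in> borel_measurable P" for g :: "_ \<Rightarrow> real"
      by (rule measurable_compose[OF measurable_Pair1'[OF \<omega>] that])
    have [measurable]: "(\<lambda>t. t) \<in> borel_measurable T" by (intro measurable_restrict_space1) simp
    have "ennreal r * (\<integral>\<^sup>+t. ennreal (exp (- r * t) * uncurried c (\<omega>, t)) \<partial>T) =
        (\<integral>\<^sup>+t. ennreal r * ennreal (exp (- r * t) * uncurried c (\<omega>, t)) \<partial>T)"
      by (rule nn_integral_cmult[symmetric]) measurable
    then have "(\<integral>\<^sup>+t. ennreal (\<psi>\<^sub>x t \<omega> * x t \<omega>) \<partial>T) + ennreal r * (\<integral>\<^sup>+t. ennreal (\<psi>\<^sub>c t \<omega> * c t \<omega>) \<partial>T) =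
      (\<integral>\<^sup>+t. ennreal (exp (- r * t) * (price (\<omega>, t) * uncurried x (\<omega>, t))) \<partial>T) +
      (\<integral>\<^sup>+t. ennreal r * ennreal (exp (- r * t) * uncurried c (\<omega>, t)) \<partial>T)"
      by (simp only: uncurried_def price_def exp_add mult.assoc split_conv)
    also have "\<dots> = (\<integral>\<^sup>+t. ennreal (exp (- r * t) * (price (\<omega>, t) * uncurried x (\<omega>, t))) +
        ennreal r * ennreal (exp (- r * t) * uncurried c (\<omega>, t)) \<partial>T)"
      by (rule nn_integral_add[symmetric]) measurable
    also have "\<dots> = (\<integral>\<^sup>+t. ennreal (exp (- r * t)) * ennreal (price (\<omega>, t) * uncurried x (\<omega>, t) + r * uncurried c (\<omega>, t)) \<partial>T)"
    proof (rule nn_integral_cong)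
      fix t assume "t \<in> space T"
      then have nn: "0 \<le> price (\<omega>, t) * uncurried x (\<omega>, t)" "0 \<le> r * uncurried c (\<omega>, t)"
        using x c \<omega> r by (auto simp: private_strategy_def uncurried_def price_def space_restrict_space)
      show "ennreal (exp (- r * t) * (price (\<omega>, t) * uncurried x (\<omega>, t))) +
        ennreal r * ennreal (exp (- r * t) * uncurried c (\<omega>, t)) =
        ennreal (exp (- r * t)) * ennreal (price (\<omega>, t) * uncurried x (\<omega>, t) + r * uncurried c (\<omega>, t))"
        unfolding ennreal_plus[OF nn] distrib_left using r
        by (simp add: ennreal_mult'[symmetric] mult.left_commute)
    qed
    finally show "(\<integral>\<^sup>+t. ennreal (\<psi>\<^sub>x t \<omega> * x t \<omega>) \<partial>T) + ennreal r * (\<integral>\<^sup>+t. ennreal (\<psi>\<^sub>c t \<omega> * c t \<omega>) \<partial>T) =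
      (\<integral>\<^sup>+t. ennreal (exp (- r * t)) * ennreal (price (\<omega>, t) * uncurried x (\<omega>, t) + r * uncurried c (\<omega>, t)) \<partial>T)" .
  qed
  also have "\<dots> = (\<integral>\<^sup>+z. ennreal (price z * uncurried x z + r * uncurried c z) \<partial>N)"
    by (rule nn_integral_N[symmetric]) measurable
  finally show ?thesis .
qed

lemma irreversible_cost_eq:
  assumes "irreversible_strategy M F x C"
  shows "irreversible_cost M \<psi>\<^sub>x \<psi>\<^sub>c x C = reversible_cost M r \<psi>\<^sub>x \<psi>\<^sub>c x C"
  unfolding irreversible_cost_def reversible_cost_def
proof (rule nn_integral_cong, rule arg_cong[where f = "(+) _"])
  fix \<omega> assume "\<omega> \<in> space M"
  then show "(\<integral>\<^sup>+t\<in>{0..}. ennreal (exp (- r * t)) \<partial>stieltjes (\<lambda>s. C s \<omega>)) =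
    ennreal r * (\<integral>\<^sup>+t\<in>{0..}. ennreal (exp (- r * t) * C t \<omega>) \<partial>lborel)"
    using assms r by (intro nn_integral_exp_stieltjes) (auto simp: irreversible_strategy_def)
qed

section \<open>Exponential moments and finiteness of payoffs\<close>

lemma expectation_exp_W:
  assumes "0 \<le> t"
  shows "(\<integral>\<^sup>+\<omega>. ennreal (exp (- k * W t \<omega>)) \<partial>M) = ennreal (exp (k\<^sup>2 * t / 2))"
proof -
  have W0: "AE \<omega> in M. W 0 \<omega> = 0" using bm by (simp add: brownian_motion_def)
  show ?thesis
  \<comment> \<open>The law of an increment is prescribed for positive time lags only; at time 0 the
    almost sure initial value is used instead.\<close>
  proof (cases "t = 0")
    case True
    have "(\<integral>\<^sup>+\<omega>. ennreal (exp (- k * W t \<omega>)) \<partial>M) = (\<integral>\<^sup>+\<omega>. 1 \<partial>M)"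
      unfolding True using W0 by (intro nn_integral_cong_AE, eventually_elim) simp
    then show ?thesis using True by (simp add: emeasure_space_1)
  next
    case False
    then have t: "0 < t" using assms by simp
    then have d: "distributed M lborel (\<lambda>\<omega>. W t \<omega> - W 0 \<omega>) (normal_density 0 (sqrt (t - 0)))"
      using bm unfolding brownian_motion_def by blast
    have "(\<integral>\<^sup>+\<omega>. ennreal (exp (- k * W t \<omega>)) \<partial>M) = (\<integral>\<^sup>+\<omega>. ennreal (exp (- k * (W t \<omega> - W 0 \<omega>))) \<partial>M)"
      using W0 by (intro nn_integral_cong_AE, eventually_elim) simp
    also have "\<dots> = (\<integral>\<^sup>+x. ennreal (normal_density 0 (sqrt (t - 0)) x) * ennreal (exp (- k * x)) \<partial>lborel)"
      by (rule distributed_nn_integral[OF d, symmetric]) measurable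
    also have "\<dots> = ennreal (exp (k\<^sup>2 * t / 2))"
      using t by (subst nn_integral_normal_exp) auto
    finally show ?thesis .
  qed
qed

lemma integral_exp_T:
  assumes a: "0 < a"
  shows "(\<integral>\<^sup>+t. ennreal (exp (- a * t)) \<partial>T) = ennreal (1 / a)"
proof -
  have "(\<integral>\<^sup>+t. ennreal (exp (- a * t)) \<partial>T) = (\<integral>\<^sup>+t. ennreal (exp (- a * t)) * indicator {0..} t \<partial>lborel)"
    by (simp add: nn_integral_restrict_space)
  also have "\<dots> = ennreal (0 - - exp (- a * 0) / a)"
  proof (rule nn_integral_FTC_atLeast)
    have "((\<lambda>t. - exp (- a * t) / a) \<longlongrightarrow> - 0 / a) at_top"
    proof (intro tendsto_divide tendsto_minus filterlim_compose[OF exp_at_bot] tendsto_const)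
      show "filterlim (\<lambda>s. - a * s) at_bot at_top"
        using a by (intro filterlim_tendsto_neg_mult_at_bot[OF tendsto_const _ filterlim_ident]) simp
    qed (use a in simp)
    then show "((\<lambda>t. - exp (- a * t) / a) \<longlongrightarrow> 0) at_top" by simp
    show "((\<lambda>t. - exp (- a * t) / a) has_real_derivative exp (- a * x)) (at x)" for x
      using a by (auto intro!: derivative_eq_intros)
  qed auto
  finally show ?thesis by simp
qed

text \<open>The exponent of the convex dual of the utility: maximising x powr \<alpha> * c powr
  \<beta> minus expenditure at the private price exp (\<sigma> * y) gives a constant times exp (- k
  * y).\<close>

definition k where "k = \<sigma> * \<alpha> / (1 - \<alpha> - \<beta>)"

text \<open>The moment grows like exp (k^2 * t / 2), so its discounted integral converges once r >
  k^2 / 2; this is precisely the lower bound imposed on sqrt (2 * r).\<close>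

lemma discounted_moment_finite: "(\<integral>\<^sup>+z. ennreal (exp (- k * uncurried W z)) \<partial>N) < \<infinity>"
proof -
  define a where "a = r - k\<^sup>2 / 2"
  have "0 \<le> k" unfolding k_def using \<sigma> exponents by simp
  then have "k\<^sup>2 < (sqrt (2 * r))\<^sup>2"
    using r_large unfolding k_def by (intro power_strict_mono) auto
  then have a: "0 < a" using r by (simp add: a_def)
  interpret pair_sigma_finite M T ..
  have "(\<integral>\<^sup>+z. ennreal (exp (- k * uncurried W z)) \<partial>N) =
      (\<integral>\<^sup>+\<omega>. (\<integral>\<^sup>+t. ennreal (exp (- r * snd (\<omega>, t))) * ennreal (exp (- k * uncurried W (\<omega>, t))) \<partial>T) \<partial>M)"
    by (subst nn_integral_N) auto
  also have "\<dots> = (\<integral>\<^sup>+t. (\<integral>\<^sup>+\<omega>. ennreal (exp (- r * snd (\<omega>, t))) * ennreal (exp (- k * uncurried W (\<omega>, t))) \<partial>M) \<partial>T)"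
    by (rule Fubini[symmetric]) measurable
  also have "\<dots> = (\<integral>\<^sup>+t. ennreal (exp (- a * t)) \<partial>T)"
  proof (rule nn_integral_cong)
    fix t assume "t \<in> space T"
    then have t: "0 \<le> t" by (simp add: space_restrict_space)
    have "W t \<in> borel_measurable (F t)" using bm t by (simp add: brownian_motion_def adapted_def)
    then have [measurable]: "W t \<in> borel_measurable M" using sub[OF t] by (rule measurable_from_subalg[rotated])
    have "(\<integral>\<^sup>+\<omega>. ennreal (exp (- r * snd (\<omega>, t))) * ennreal (exp (- k * uncurried W (\<omega>, t))) \<partial>M) =
        ennreal (exp (- r * t)) * (\<integral>\<^sup>+\<omega>. ennreal (exp (- k * W t \<omega>)) \<partial>M)"
      by (simp add: nn_integral_cmult uncurried_def)
    also have "\<dots> = ennreal (exp (- r * t) * exp (k\<^sup>2 * t / 2))"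
      using expectation_exp_W[OF t] by (simp add: ennreal_mult')
    also have "exp (- r * t) * exp (k\<^sup>2 * t / 2) = exp (- a * t)"
      by (simp add: a_def algebra_simps flip: exp_add)
    finally show "(\<integral>\<^sup>+\<omega>. ennreal (exp (- r * snd (\<omega>, t))) * ennreal (exp (- k * uncurried W (\<omega>, t))) \<partial>M) =
      ennreal (exp (- a * t))" .
  qed
  also have "\<dots> = ennreal (1 / a)" by (rule integral_exp_T[OF a])
  finally show ?thesis by simp
qed

text \<open>Measured in units of \<open>h\<close>, spending on the two goods enters the affine AM-GM
  bound directly. These units fit because \<open>h\<close> is reproduced by the homogeneity: h = exp
  (- \<sigma> * y) powr \<alpha> * h powr (\<alpha> + \<beta>), which is what the choice of
  \<open>k\<close> achieves.\<close>

lemma utility_bound: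
  assumes "0 \<le> x" "0 \<le> c"
  shows "cobb_douglas \<alpha> \<beta> x c \<le> r powr - \<beta> / (\<alpha> + \<beta>) * (exp (- k * y) + (exp (\<sigma> * y) * x + r * c))"
proof -
  define h where "h = exp (- k * y)"
  define s where "s = exp (\<sigma> * y) * x / h"
  define t where "t = r * c / h"
  have h: "0 < h" by (simp add: h_def)
  have st: "0 \<le> s" "0 \<le> t" using h assms r by (simp_all add: s_def t_def)
  have x: "x = exp (- \<sigma> * y) * h * s" and c: "c = 1 / r * h * t"
    using h r by (simp_all add: s_def t_def exp_minus)
  have "h = exp (- \<sigma> * y) powr \<alpha> * h powr (\<alpha> + \<beta>)"
  proof -
    have "- k * y = \<alpha> * (- \<sigma> * y) + (\<alpha> + \<beta>) * (- k * y)"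
    proof -
      have "k * (1 - \<alpha> - \<beta>) = \<sigma> * \<alpha>" unfolding k_def using exponents by simp
      then have "k * (1 - \<alpha> - \<beta>) * y = \<sigma> * \<alpha> * y" by simp
      then show ?thesis by (simp add: algebra_simps)
    qed
    moreover have "exp z powr a = exp (a * z)" for a z :: real by (simp add: powr_def)
    ultimately show ?thesis unfolding h_def by (simp only: exp_add[symmetric])
  qed
  note hh = this
  have "x powr \<alpha> * c powr \<beta> = r powr - \<beta> * (exp (- \<sigma> * y) powr \<alpha> * h powr (\<alpha> + \<beta>)) * (s powr \<alpha> * t powr \<beta>)"
    unfolding x c using h st r by (simp add: powr_mult powr_add powr_minus divide_inverse inverse_powr)
  also have "\<dots> = r powr - \<beta> * (h * (s powr \<alpha> * t powr \<beta>))" unfolding hh[symmetric] by simp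
  also have "\<dots> \<le> r powr - \<beta> * (h + h * (s + t))"
  proof (intro mult_left_mono)
    have "s powr \<alpha> * t powr \<beta> \<le> (1 - \<alpha> - \<beta>) + \<alpha> * s + \<beta> * t"
      using exponents st by (intro powr_mult_powr_le_affine)
    also have "\<dots> \<le> 1 + 1 * s + 1 * t"
      using exponents st by (intro add_mono mult_right_mono) auto
    finally have "h * (s powr \<alpha> * t powr \<beta>) \<le> h * (1 + 1 * s + 1 * t)"
      using h by (intro mult_left_mono) auto
    then show "h * (s powr \<alpha> * t powr \<beta>) \<le> h + h * (s + t)" by (simp add: algebra_simps)
  qed simp
  also have "h * (s + t) = exp (\<sigma> * y) * x + r * c" using h by (simp add: s_def t_def distrib_left)
  finally show ?thesis using exponents
    by (simp add: cobb_douglas_def h_def divide_right_mono)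
qed

lemma payoff_finite:
  assumes [measurable]: "f \<in> borel_measurable P" "g \<in> borel_measurable P"
    and nn: "\<And>z. z \<in> space P \<Longrightarrow> 0 \<le> f z" "\<And>z. z \<in> space P \<Longrightarrow> 0 \<le> g z"
    and fin: "(\<integral>\<^sup>+z. ennreal (price z * f z + r * g z) \<partial>N) < \<infinity>"
  shows "(\<integral>\<^sup>+z. ennreal (cobb_douglas \<alpha> \<beta> (f z) (g z)) \<partial>N) < \<infinity>"
proof -
  let ?c = "r powr - \<beta> / (\<alpha> + \<beta>)"
  have c: "0 \<le> ?c" using exponents by simp
  have "(\<integral>\<^sup>+z. ennreal (cobb_douglas \<alpha> \<beta> (f z) (g z)) \<partial>N) \<le>
      (\<integral>\<^sup>+z. ennreal (?c * exp (- k * uncurried W z) + ?c * (price z * f z + r * g z)) \<partial>N)"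
  proof (intro nn_integral_mono ennreal_leI)
    fix z assume "z \<in> space N"
    then have "z \<in> space P" by (simp add: N_def)
    from utility_bound[OF nn[OF this], of "uncurried W z"]
    show "cobb_douglas \<alpha> \<beta> (f z) (g z) \<le> ?c * exp (- k * uncurried W z) + ?c * (price z * f z + r * g z)"
      by (simp only: price_def distrib_left)
  qed
  also have "\<dots> = ennreal ?c * (\<integral>\<^sup>+z. ennreal (exp (- k * uncurried W z)) \<partial>N) +
      ennreal ?c * (\<integral>\<^sup>+z. ennreal (price z * f z + r * g z) \<partial>N)"
  proof (rule nn_integral_linear_combination)
    fix z assume "z \<in> space N"
    then have "z \<in> space P" by (simp add: N_def)
    with nn[of z] r show "0 \<le> price z * f z + r * g z" by (simp add: price_def)
  qed (use c in simp_all)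
  also have "\<dots> < \<infinity>" using fin discounted_moment_finite by (simp add: ennreal_mult_less_top)
  finally show ?thesis .
qed

section \<open>An interior bundle of finite cost\<close>

lemma private_exp_W: "private_strategy M F (\<lambda>t \<omega>. exp (- \<sigma> * W t \<omega>))"
  unfolding private_strategy_def
proof (intro conjI optional_processI)
  show "adapted F (\<lambda>t \<omega>. exp (- \<sigma> * W t \<omega>))"
    unfolding adapted_def
  proof (intro allI impI)
    fix t :: real assume "0 \<le> t"
    then have [measurable]: "W t \<in> borel_measurable (F t)" using bm by (simp add: brownian_motion_def adapted_def)
    show "(\<lambda>\<omega>. exp (- \<sigma> * W t \<omega>)) \<in> borel_measurable (F t)" by measurable
  qed
  fix \<omega> assume "\<omega> \<in> space M"
  then have "continuous_on {0..} (\<lambda>t. W t \<omega>)" using bm by (simp add: brownian_motion_def)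
  then show "cadlag (\<lambda>t. exp (- \<sigma> * W t \<omega>))"
    by (intro cadlag_continuous continuous_intros)
qed simp

lemma private_one: "private_strategy M F (\<lambda>t \<omega>. 1)"
  unfolding private_strategy_def
  by (intro conjI optional_processI) (auto simp: adapted_def cadlag_def)

lemma private_add:
  "private_strategy M F x \<Longrightarrow> private_strategy M F y \<Longrightarrow> private_strategy M F (\<lambda>t \<omega>. x t \<omega> + y t \<omega>)"
  by (auto simp: private_strategy_def intro: optional_process_add)

lemma private_scale:
  "0 \<le> a \<Longrightarrow> private_strategy M F x \<Longrightarrow> private_strategy M F (\<lambda>t \<omega>. a * x t \<omega>)"
  by (auto simp: private_strategy_def intro: optional_process_scale)

text \<open>Consumption is the reciprocal of its price and the contribution stock is constant, so
  spending per unit of discounted time is the deterministic number 1 + r. A constant stock is a lump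
  sum paid at time 0, hence admissible in both economies.\<close>

lemma interior_cost_finite:
  "(\<integral>\<^sup>+z. ennreal (price z * uncurried (\<lambda>t \<omega>. exp (- \<sigma> * W t \<omega>)) z + r * uncurried (\<lambda>t \<omega>. 1) z) \<partial>N) < \<infinity>"
proof -
  have "price z * uncurried (\<lambda>t \<omega>. exp (- \<sigma> * W t \<omega>)) z + r * uncurried (\<lambda>t \<omega>. 1) z = 1 + r" for z
    by (cases z) (simp add: price_def uncurried_apply flip: exp_add)
  moreover have "(\<integral>\<^sup>+z. ennreal (1 + r) \<partial>N) =
      (\<integral>\<^sup>+\<omega>. (\<integral>\<^sup>+t. ennreal (exp (- r * t)) * ennreal (1 + r) \<partial>T) \<partial>M)"
    by (rule nn_integral_N) measurable
  moreover have "(\<integral>\<^sup>+t. ennreal (exp (- r * t)) * ennreal (1 + r) \<partial>T) = ennreal (1 / r) * ennreal (1 + r)"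
  proof -
    have [measurable]: "(\<lambda>t. t) \<in> borel_measurable T" by (intro measurable_restrict_space1) simp
    have "(\<integral>\<^sup>+t. ennreal (exp (- r * t)) * ennreal (1 + r) \<partial>T) = (\<integral>\<^sup>+t. ennreal (exp (- r * t)) \<partial>T) * ennreal (1 + r)"
      by (rule nn_integral_multc) measurable
    then show ?thesis by (simp only: integral_exp_T[OF r])
  qed
  ultimately show ?thesis by (simp add: emeasure_space_1 ennreal_mult_less_top)
qed

text \<open>\<open>K\<close> is the cone of admissible contribution paths. \<open>\<Psi>\<close> is
  kept abstract and compared with the reversible cost on strategies only, because the Stieltjes cost
  agrees with it only for monotone right-continuous paths.\<close>

proposition equilibrium_share:
  fixes S :: "'a process \<Rightarrow> 'a process \<Rightarrow> bool" and K :: "'a process \<Rightarrow> bool"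
    and n :: nat and x C x' C' :: "nat \<Rightarrow> 'a process"
  assumes S: "\<And>x c. S x c \<longleftrightarrow> private_strategy M F x \<and> K c"
    and K_private: "\<And>c. K c \<Longrightarrow> private_strategy M F c"
    and K_add: "\<And>c d. K c \<Longrightarrow> K d \<Longrightarrow> K (\<lambda>t \<omega>. c t \<omega> + d t \<omega>)"
    and K_scale: "\<And>a c. 0 \<le> a \<Longrightarrow> K c \<Longrightarrow> K (\<lambda>t \<omega>. a * c t \<omega>)"
    and K_one: "K (\<lambda>t \<omega>. 1)"
    and cost: "\<And>x c. S x c \<Longrightarrow> \<Psi> x c = reversible_cost M r \<psi>\<^sub>x \<psi>\<^sub>c x c"
    and n: "1 \<le> n" and w: "0 < w"
    and planner: "planner_optimum S \<Psi> (payoff M r (cobb_douglas \<alpha> \<beta>)) n w x C"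
    and nash: "nash_equilibrium S \<Psi> (payoff M r (cobb_douglas \<alpha> \<beta>)) n w x' C'"
    and symmetric: "symmetric_profile M n x' C'"
  shows "AE (\<omega>, t) in P. 0 < aggregate n C t \<omega> \<and>
    aggregate n C' t \<omega> = (\<alpha> + \<beta>) / (real n * \<alpha> + \<beta>) * aggregate n C t \<omega>"
proof -
  define A where "A = uncurried ` Collect (private_strategy M F)"
  define B where "B = uncurried ` Collect K"
  have A: "uncurried y \<in> A" if "private_strategy M F y" for y using that by (simp add: A_def)
  have B: "uncurried E \<in> B" if "K E" for E using that by (simp add: B_def)
  have nonneg: "0 \<le> uncurried y z" if "private_strategy M F y" "z \<in> space N" for y z
    using that by (auto simp: private_strategy_def space_N uncurried_def)
  interpret market: cobb_douglas_market N A B price "\<lambda>_. r" \<alpha> \<beta> w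
  proof
    show "price \<in> borel_measurable N" by measurable
    show "f \<in> borel_measurable N" if "f \<in> A" for f
      using that private_measurable by (auto simp: A_def)
    show "f \<in> borel_measurable N" if "f \<in> B" for f
      using that K_private private_measurable by (auto simp: B_def)
    show "0 \<le> f z" if "f \<in> A" "z \<in> space N" for f z
      using that nonneg unfolding A_def by blast
    show "0 \<le> f z" if "f \<in> B" "z \<in> space N" for f z
      using that nonneg K_private unfolding B_def by blast
    show "(\<lambda>z. f z + g z) \<in> A" if fg: "f \<in> A" "g \<in> A" for f g
    proof -
      obtain y y' where y: "f = uncurried y" "g = uncurried y'" "private_strategy M F y" "private_strategy M F y'"
        using fg by (auto simp: A_def)
      have "(\<lambda>z. f z + g z) = uncurried (\<lambda>t \<omega>. y t \<omega> + y' t \<omega>)" by (auto simp: y uncurried_def)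
      then show ?thesis using A[OF private_add[OF y(3,4)]] by simp
    qed
    show "(\<lambda>z. f z + g z) \<in> B" if fg: "f \<in> B" "g \<in> B" for f g
    proof -
      obtain y y' where y: "f = uncurried y" "g = uncurried y'" "K y" "K y'"
        using fg by (auto simp: B_def)
      have "(\<lambda>z. f z + g z) = uncurried (\<lambda>t \<omega>. y t \<omega> + y' t \<omega>)" by (auto simp: y uncurried_def)
      then show ?thesis using B[OF K_add[OF y(3,4)]] by simp
    qed
    show "(\<lambda>z. a * f z) \<in> A" if a: "0 \<le> a" and f: "f \<in> A" for a f
    proof -
      obtain y where y: "f = uncurried y" "private_strategy M F y" using f by (auto simp: A_def)
      have "(\<lambda>z. a * f z) = uncurried (\<lambda>t \<omega>. a * y t \<omega>)" by (auto simp: y uncurried_def)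
      then show ?thesis using A[OF private_scale[OF a y(2)]] by simp
    qed
    show "(\<lambda>z. a * f z) \<in> B" if a: "0 \<le> a" and f: "f \<in> B" for a f
    proof -
      obtain y where y: "f = uncurried y" "K y" using f by (auto simp: B_def)
      have "(\<lambda>z. a * f z) = uncurried (\<lambda>t \<omega>. a * y t \<omega>)" by (auto simp: y uncurried_def)
      then show ?thesis using B[OF K_scale[OF a y(2)]] by simp
    qed
    show "\<exists>f\<in>A. \<exists>g\<in>B. (\<forall>z\<in>space N. 0 < f z \<and> 0 < g z) \<and>
        (\<integral>\<^sup>+z. ennreal (price z * f z + r * g z) \<partial>N) < \<infinity>"
      using A[OF private_exp_W] B[OF K_one] interior_cost_finite
      by (intro bexI conjI) (auto simp: uncurried_def)
    show "(\<integral>\<^sup>+z. ennreal (cobb_douglas \<alpha> \<beta> (f z) (g z)) \<partial>N) < \<infinity>"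
      if fg: "f \<in> A" "g \<in> B" and fin: "(\<integral>\<^sup>+z. ennreal (price z * f z + r * g z) \<partial>N) < \<infinity>" for f g
    proof -
      obtain y E where y: "f = uncurried y" "g = uncurried E" "private_strategy M F y" "private_strategy M F E"
        using fg K_private by (auto simp: A_def B_def)
      show ?thesis
        using fin unfolding y(1,2) using nonneg[OF y(3)] nonneg[OF y(4)]
        by (intro payoff_finite private_measurable y) (auto simp: N_def)
    qed
  qed (use exponents w r in \<open>simp_all add: price_def\<close>)
  have cost_eq: "market.cost (uncurried y) (uncurried E) = \<Psi> y E" if "private_strategy M F y" "K E" for y E
    unfolding market.cost_def using that cost reversible_cost_eq K_private S by simp
  \<comment> \<open>Aggregates are known only at nonnegative times and on the space of
    \<open>M\<close>, so the process \<open>c\<close> in the payoff may differ elsewhere from the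
    cone member \<open>E\<close> that represents it.\<close>
  have utility_eq: "market.utility (uncurried y) g = payoff M r (cobb_douglas \<alpha> \<beta>) y c"
    if "private_strategy M F y" "private_strategy M F E" "g = uncurried E"
      "\<And>t \<omega>. 0 \<le> t \<Longrightarrow> \<omega> \<in> space M \<Longrightarrow> c t \<omega> = E t \<omega>" for y g c E
  proof -
    have "payoff M r (cobb_douglas \<alpha> \<beta>) y c = payoff M r (cobb_douglas \<alpha> \<beta>) y E"
      using that(4) by (rule payoff_cong)
    also have "\<dots> = market.utility (uncurried y) g"
      unfolding market.utility_def that(3)
      by (rule payoff_eq[OF private_measurable[OF that(1)] private_measurable[OF that(2)]])
    finally show ?thesis by simp
  qed
  have n0: "0 < n" using n by simp
  have prof: "private_strategy M F (x' 0)" "K (C' 0)" "\<Psi> (x' 0) (C' 0) \<le> ennreal w"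
    and best: "\<And>y E. S y E \<Longrightarrow> \<Psi> y E \<le> ennreal w \<Longrightarrow>
      payoff M r (cobb_douglas \<alpha> \<beta>) y (\<lambda>t \<omega>. aggregate_others n C' 0 t \<omega> + E t \<omega>)
        \<le> payoff M r (cobb_douglas \<alpha> \<beta>) (x' 0) (aggregate n C')"
    using nash n0 S unfolding nash_equilibrium_def by blast+
  \<comment> \<open>By symmetry agent 0 can represent all agents; the others together contribute n -
    1 copies of his path.\<close>
  have sym: "C' i t \<omega> = C' 0 t \<omega>" if "i < n" "0 \<le> t" "\<omega> \<in> space M" for i t \<omega>
    using symmetric n0 that unfolding symmetric_profile_def by blast
  have agg: "aggregate n C' t \<omega> = real n * C' 0 t \<omega>" if "0 \<le> t" "\<omega> \<in> space M" for t \<omega>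
  proof -
    have "aggregate n C' t \<omega> = (\<Sum>i<n. C' 0 t \<omega>)"
      unfolding aggregate_def by (intro sum.cong refl sym that) simp
    then show ?thesis by simp
  qed
  have others: "aggregate_others n C' 0 t \<omega> = (real n - 1) * C' 0 t \<omega>" if "0 \<le> t" "\<omega> \<in> space M" for t \<omega>
  proof -
    have "aggregate_others n C' 0 t \<omega> = (\<Sum>j\<in>{..<n} - {0}. C' 0 t \<omega>)"
      unfolding aggregate_others_def by (intro sum.cong refl sym that) simp
    then show ?thesis using n0 by (simp add: of_nat_diff)
  qed
  interpret eq: symmetric_equilibrium N A B price "\<lambda>_. r" \<alpha> \<beta> w "real n" "uncurried (x' 0)" "uncurried (C' 0)"
  proof
    show "market.cost (uncurried (x' 0)) (uncurried (C' 0)) \<le> ennreal w" using prof by (simp add: cost_eq)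
    fix y E assume yE: "y \<in> A" "E \<in> B" "market.cost y E \<le> ennreal w"
    then obtain y' E' where y': "y = uncurried y'" "E = uncurried E'" "private_strategy M F y'" "K E'"
      by (auto simp: A_def B_def)
    have KE: "K (\<lambda>t \<omega>. (real n - 1) * C' 0 t \<omega> + E' t \<omega>)"
      using n by (intro K_add K_scale y' prof) simp
    have "market.utility y (\<lambda>z. (real n - 1) * uncurried (C' 0) z + E z) =
        payoff M r (cobb_douglas \<alpha> \<beta>) y' (\<lambda>t \<omega>. aggregate_others n C' 0 t \<omega> + E' t \<omega>)"
      unfolding y'(1,2) by (rule utility_eq[OF y'(3) K_private[OF KE]]) (auto simp: uncurried_def others)
    also have "\<dots> \<le> payoff M r (cobb_douglas \<alpha> \<beta>) (x' 0) (aggregate n C')"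
      using yE y' by (intro best) (simp_all add: S cost_eq)
    also have "\<dots> = market.utility (uncurried (x' 0)) (\<lambda>z. real n * uncurried (C' 0) z)"
    proof (rule utility_eq[symmetric, OF prof(1) K_private])
      show "K (\<lambda>t \<omega>. real n * C' 0 t \<omega>)" by (intro K_scale prof) simp
    qed (auto simp: uncurried_def agg)
    finally show "market.utility y (\<lambda>z. (real n - 1) * uncurried (C' 0) z + E z) \<le>
      market.utility (uncurried (x' 0)) (\<lambda>z. real n * uncurried (C' 0) z)" .
  qed (use n A B prof in simp_all)
  have pl: "\<And>i. i < n \<Longrightarrow> private_strategy M F (x i)" "\<And>i. i < n \<Longrightarrow> K (C i)"
    and budget: "(\<Sum>i<n. \<Psi> (x i) (C i)) \<le> ennreal (real n * w)"
    and opt: "\<And>y E. planner_feasible S \<Psi> n w y E \<Longrightarrow>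
      average_payoff (payoff M r (cobb_douglas \<alpha> \<beta>)) n y E \<le> average_payoff (payoff M r (cobb_douglas \<alpha> \<beta>)) n x C"
    using planner S unfolding planner_optimum_def planner_feasible_def by auto
  have K_sum: "K (\<lambda>t \<omega>. \<Sum>j<l. C j t \<omega>)" if "0 < l" "l \<le> n" for l
    using that
  proof (induction l rule: nat_induct_non_zero)
    case 1
    then show ?case using pl(2) by simp
  next
    case (Suc l)
    then show ?case using K_add[OF Suc.IH pl(2)[of l]] by simp
  qed
  have "AE z in N. 0 < (\<Sum>j<n. uncurried (C j) z) \<and> real n * uncurried (C' 0) z =
      (\<alpha> + \<beta>) / (real n * \<alpha> + \<beta>) * (\<Sum>j<n. uncurried (C j) z)"
  proof (rule eq.planner_comparison[where x = "\<lambda>i. uncurried (x i)"])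
    show "(\<Sum>i<n. market.cost (uncurried (x i)) (uncurried (C i))) \<le> ennreal (real n * w)"
      using budget pl by (simp add: cost_eq)
    fix y E assume yE: "y \<in> A" "E \<in> B" "market.cost y E \<le> ennreal w"
    then obtain y' E' where y': "y = uncurried y'" "E = uncurried E'" "private_strategy M F y'" "K E'"
      by (auto simp: A_def B_def)
    have KE: "K (\<lambda>t \<omega>. real n * E' t \<omega>)" by (intro K_scale y') simp
    have "(\<Sum>i<n. \<Psi> y' E') \<le> of_nat n * ennreal w"
      using yE y' by (simp add: cost_eq mult_left_mono)
    also have "\<dots> = ennreal (real n * w)"
      by (simp add: ennreal_mult' ennreal_of_nat_eq_real_of_nat)
    finally have "planner_feasible S \<Psi> n w (\<lambda>_. y') (\<lambda>_. E')"
      using y' by (simp add: planner_feasible_def S)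
    from opt[OF this] have "ennreal (1 / real n) * (\<Sum>i<n. payoff M r (cobb_douglas \<alpha> \<beta>) y' (aggregate n (\<lambda>_. E'))) \<le>
        ennreal (1 / real n) * (\<Sum>i<n. payoff M r (cobb_douglas \<alpha> \<beta>) (x i) (aggregate n C))"
      unfolding average_payoff_def sum_distrib_left .
    then have "(\<Sum>i<n. payoff M r (cobb_douglas \<alpha> \<beta>) y' (aggregate n (\<lambda>_. E'))) \<le>
        (\<Sum>i<n. payoff M r (cobb_douglas \<alpha> \<beta>) (x i) (aggregate n C))"
      using n0 by (subst (asm) ennreal_mult_le_mult_iff) auto
    moreover have "payoff M r (cobb_douglas \<alpha> \<beta>) y' (aggregate n (\<lambda>_. E')) = market.utility y (\<lambda>z. real n * E z)"
      unfolding y'(1,2)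
      by (rule utility_eq[symmetric, OF y'(3) K_private[OF KE]]) (auto simp: uncurried_def aggregate_def)
    moreover have "payoff M r (cobb_douglas \<alpha> \<beta>) (x i) (aggregate n C) =
        market.utility (uncurried (x i)) (\<lambda>z. \<Sum>j<n. uncurried (C j) z)" if "i < n" for i
      by (rule utility_eq[symmetric, OF pl(1)[OF that] K_private[OF K_sum[OF n0 order_refl]]])
        (auto simp: uncurried_def aggregate_def)
    ultimately show "(\<Sum>i<n. market.utility y (\<lambda>z. real n * E z)) \<le>
        (\<Sum>i<n. market.utility (uncurried (x i)) (\<lambda>z. \<Sum>j<n. uncurried (C j) z))"
      by simp
  qed (use pl A B in auto)
  \<comment> \<open>The discount density is strictly positive, so \<open>N\<close> and the product
    measure have the same null sets.\<close>
  then have "AE z in P. 0 < (\<Sum>j<n. uncurried (C j) z) \<and> real n * uncurried (C' 0) z =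
      (\<alpha> + \<beta>) / (real n * \<alpha> + \<beta>) * (\<Sum>j<n. uncurried (C j) z)"
    unfolding N_def by (subst (asm) AE_density) auto
  with AE_space show ?thesis
  proof eventually_elim
    case (elim z)
    then obtain \<omega> t where z: "z = (\<omega>, t)" "\<omega> \<in> space M" "0 \<le> t" by (auto simp: space_time_product)
    then show ?case using elim agg[OF z(3,2)] by (simp add: uncurried_apply aggregate_def)
  qed
qed

section \<open>The two economies as instances\<close>

lemma irreversible_equilibrium_share:
  assumes "1 \<le> n" "0 < w"
    and "planner_optimum (irreversible_strategy M F) (irreversible_cost M \<psi>\<^sub>x \<psi>\<^sub>c)
      (payoff M r (cobb_douglas \<alpha> \<beta>)) n w x C"
    and "nash_equilibrium (irreversible_strategy M F) (irreversible_cost M \<psi>\<^sub>x \<psi>\<^sub>c)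
      (payoff M r (cobb_douglas \<alpha> \<beta>)) n w x' C'"
    and "symmetric_profile M n x' C'"
  shows "AE (\<omega>, t) in P. 0 < aggregate n C t \<omega> \<and>
    aggregate n C' t \<omega> = (\<alpha> + \<beta>) / (real n * \<alpha> + \<beta>) * aggregate n C t \<omega>"
proof (rule equilibrium_share[OF _ _ _ _ _ _ assms])
  \<comment> \<open>Monotone right-continuous paths are closed under sums and nonnegative multiples,
    though not under differences; this is all that the abstract argument asks of
    \<open>K\<close>.\<close>
  let ?K = "\<lambda>C. private_strategy M F C \<and> (\<forall>\<omega>\<in>space M. mono_on {0..} (\<lambda>t. C t \<omega>) \<and>
    (\<forall>t\<ge>0. continuous (at_right t) (\<lambda>s. C s \<omega>)))"
  show "irreversible_strategy M F x c \<longleftrightarrow> private_strategy M F x \<and> ?K c" for x c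
    by (auto simp: irreversible_strategy_def private_strategy_def)
  show "?K (\<lambda>t \<omega>. c t \<omega> + d t \<omega>)" if "?K c" "?K d" for c d
    using that by (auto intro!: private_add continuous_intros mono_onI add_mono dest: mono_onD)
  show "?K (\<lambda>t \<omega>. a * c t \<omega>)" if "0 \<le> a" "?K c" for a c
    using that by (auto intro!: private_scale continuous_intros mono_onI mult_left_mono dest: mono_onD)
  show "?K (\<lambda>t \<omega>. 1)" by (auto intro!: private_one mono_onI)
qed (blast intro: irreversible_cost_eq)+

lemma reversible_equilibrium_share:
  assumes "1 \<le> n" "0 < w"
    and "planner_optimum (reversible_strategy M F) (reversible_cost M r \<psi>\<^sub>x \<psi>\<^sub>c)
      (payoff M r (cobb_douglas \<alpha> \<beta>)) n w x C"
    and "nash_equilibrium (reversible_strategy M F) (reversible_cost M r \<psi>\<^sub>x \<psi>\<^sub>c)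
      (payoff M r (cobb_douglas \<alpha> \<beta>)) n w x' C'"
    and "symmetric_profile M n x' C'"
  shows "AE (\<omega>, t) in P. 0 < aggregate n C t \<omega> \<and>
    aggregate n C' t \<omega> = (\<alpha> + \<beta>) / (real n * \<alpha> + \<beta>) * aggregate n C t \<omega>"
proof (rule equilibrium_share[where K = "private_strategy M F", OF _ _ _ _ _ _ assms])
  show "reversible_strategy M F x c \<longleftrightarrow> private_strategy M F x \<and> private_strategy M F c" for x c
    by (auto simp: reversible_strategy_def private_strategy_def)
qed (auto intro: private_add private_scale private_one)

end

text \<open>Positivity of both planner aggregates is part of the conclusion, so the quotients are
  genuine and do not rest on the convention x / 0 = 0.\<close>

theorem corollary5p9:
  fixes M :: "'a measure" and F :: "real \<Rightarrow> 'a measure"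
    and W \<psi>\<^sub>x \<psi>\<^sub>c :: "'a process"
    and n :: nat and r w\<^sub>o \<alpha> \<beta> \<sigma> :: real
    and x\<^sub>I C\<^sub>I x\<^sub>I' C\<^sub>I' x\<^sub>R c\<^sub>R x\<^sub>R' c\<^sub>R' :: "nat \<Rightarrow> 'a process"
    and C_star C_hat c_star c_hat :: "'a process"
  assumes basis: "usual_conditions M F"
    and bm: "brownian_motion M F W"
    and n: "n \<ge> 1" and r: "r > 0" and w\<^sub>o: "w\<^sub>o > 0" and \<sigma>: "\<sigma> > 0"
    and \<alpha>: "0 < \<alpha>" "\<alpha> < 1" and \<beta>: "0 < \<beta>" "\<beta> < 1" and \<alpha>\<beta>: "\<alpha> + \<beta> < 1"
    and r_large: "sqrt (2 * r) > \<sigma> * \<alpha> / (1 - \<alpha> - \<beta>)"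
    and price_x: "\<psi>\<^sub>x = (\<lambda>t \<omega>. exp (- r * t + \<sigma> * W t \<omega>))"
    and price_c: "\<psi>\<^sub>c = (\<lambda>t \<omega>. exp (- r * t))"
    and planner_irreversible:
      "planner_optimum (irreversible_strategy M F) (irreversible_cost M \<psi>\<^sub>x \<psi>\<^sub>c)
         (payoff M r (cobb_douglas \<alpha> \<beta>)) n w\<^sub>o x\<^sub>I C\<^sub>I"
    and nash_irreversible:
      "nash_equilibrium (irreversible_strategy M F) (irreversible_cost M \<psi>\<^sub>x \<psi>\<^sub>c)
         (payoff M r (cobb_douglas \<alpha> \<beta>)) n w\<^sub>o x\<^sub>I' C\<^sub>I'"
      "symmetric_profile M n x\<^sub>I' C\<^sub>I'"
    and planner_reversible:
      "planner_optimum (reversible_strategy M F) (reversible_cost M r \<psi>\<^sub>x \<psi>\<^sub>c)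
         (payoff M r (cobb_douglas \<alpha> \<beta>)) n w\<^sub>o x\<^sub>R c\<^sub>R"
    and nash_reversible:
      "nash_equilibrium (reversible_strategy M F) (reversible_cost M r \<psi>\<^sub>x \<psi>\<^sub>c)
         (payoff M r (cobb_douglas \<alpha> \<beta>)) n w\<^sub>o x\<^sub>R' c\<^sub>R'"
      "symmetric_profile M n x\<^sub>R' c\<^sub>R'"
    and aggregates:
      "C_star = aggregate n C\<^sub>I" "C_hat = aggregate n C\<^sub>I'"
      "c_star = aggregate n c\<^sub>R" "c_hat = aggregate n c\<^sub>R'"
  shows "AE (\<omega>, t) in M \<Otimes>\<^sub>M restrict_space lborel {0..}.
           0 < C_star t \<omega> \<and> 0 < c_star t \<omega> \<and>
           C_hat t \<omega> / C_star t \<omega> = c_hat t \<omega> / c_star t \<omega> \<and>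
           c_hat t \<omega> / c_star t \<omega> \<le> 1"
proof -
  interpret brownian_economy M F W r \<sigma> \<alpha> \<beta>
    using basis bm r \<sigma> \<alpha> \<beta> \<alpha>\<beta> r_large by unfold_locales auto
  \<comment> \<open>The common ratio is at most 1 because n \<ge> 1; free-riding shows in the factor
    n that multiplies \<alpha> in the denominator.\<close>
  have "1 * \<alpha> \<le> real n * \<alpha>" using n \<alpha> by (intro mult_right_mono) auto
  then have "(\<alpha> + \<beta>) / (real n * \<alpha> + \<beta>) \<le> 1"
    using \<alpha> \<beta> by (simp add: divide_le_eq_1_pos add_nonneg_pos)
  note ratio = this
  from irreversible_equilibrium_share[OF n w\<^sub>o planner_irreversible[unfolded price_x price_c]
      nash_irreversible(1)[unfolded price_x price_c] nash_irreversible(2)]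
    reversible_equilibrium_share[OF n w\<^sub>o planner_reversible[unfolded price_x price_c]
      nash_reversible(1)[unfolded price_x price_c] nash_reversible(2)]
  show ?thesis
  proof eventually_elim
    case (elim z)
    then show ?case using ratio by (cases z) (auto simp: aggregates)
  qed
qed

end
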